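(* Let $X$ be a path-connected ANR space, $R$ a ring, and let $H^*$ denote Alexander–Spanier cohomology. Suppose that $\beta_i^*\in H^{k_i}(SP^2(X\times X);R)$ with $k_i\ge1$, for $i=1,2$. Let $\beta_i\in H^{k_i}(X\times X;R)$ be the image of $\beta_i^*$ under the homomorphism induced by the inclusion $X\times X\to SP^2(X\times X)$. If $\beta_1$ and $\beta_2$ are zero-divisors such that $\beta_1\smile\beta_2\neq 0$, then $\mathsf{iTC}(X)\ge 2$.
   Context: For a space $Y$, $SP^2(Y)$ is the orbit space of $Y\times Y$ under the action of the symmetric group $S_2$ permuting coordinates; the inclusion $Y\to SP^2(Y)$ is the diagonal map $y\mapsto[y,y]$. A class $\beta\in H^*(X\times X;R)$ is a zero-divisor if $\Delta^*(\beta)=0$, where $\Delta:X\to X\times X$ is the diagonal map. $I=[0,1]$. For a metric space $Z$ and $n\ge 1$, $\mathcal B_n(Z)$ is the space of probability measures on $Z$ whose support has at most $n$ points, written as finite formal convex combinations $\sum\lambda_z z$ with $\lambda_z>0$, $\sum\lambda_z=1$, equipped with the Lévy–Prokhorov metric; $\delta_z$ is the Dirac measure at $z$. $P(Z)$ is the space of continuous paths $I\to Z$ with the compact-open topology. Define $\Phi_n:\mathcal B_n(P(X))\to P(\mathcal B_n(X))$ by $\Phi_n(\sum\lambda_\alpha\alpha)(t)=\sum\lambda_\alpha\alpha(t)$. A path $f\in P(\mathcal B_n(X))$ is resolvable if $f=\Phi_n(\mu)$ for some $\mu\in\mathcal B_n(P(X))$; $RP(\mathcal B_n(X))\subset P(\mathcal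 B_n(X))$ is the subspace of resolvable paths. $\mathsf{iTC}(X)$ is the minimal integer $n\ge 0$ such that there is a continuous map $s:X\times X\to RP(\mathcal B_{n+1}(X))$ with $s(x,y)(0)=\delta_x$ and $s(x,y)(1)=\delta_y$ for all $(x,y)\in X\times X$ (infinite if no such $n$ exists). *)

theory Defs
  imports
    "HOL-Probability.Probability"
    "HOL-Algebra.Coset"
    "HOL-Library.Uprod"
    "HOL-Library.Extended_Nat"
begin

section \<open>Symmetric squares\<close>

definition SP2 :: "'a topology \<Rightarrow> 'a uprod topology" where
  "SP2 Y = topology (\<lambda>U. U \<subseteq> case_prod Upair ` topspace (prod_topology Y Y) \<and>
      openin (prod_topology Y Y) {p \<in> topspace (prod_topology Y Y). case_prod Upair p \<in> U})"

lemma openin_SP2: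
  "openin (SP2 Y) U \<longleftrightarrow> U \<subseteq> case_prod Upair ` topspace (prod_topology Y Y) \<and>
      openin (prod_topology Y Y) {p \<in> topspace (prod_topology Y Y). case_prod Upair p \<in> U}"
    (is "_ \<longleftrightarrow> ?P U")
proof -
  let ?T = "topspace (prod_topology Y Y)"
  have "istopology ?P"
    unfolding istopology_def
  proof (intro conjI allI impI)
    fix S T assume "?P S" "?P T"
    moreover have "{p \<in> ?T. case_prod Upair p \<in> S \<inter> T} =
        {p \<in> ?T. case_prod Upair p \<in> S} \<inter> {p \<in> ?T. case_prod Upair p \<in> T}"
      by auto
    ultimately show "S \<inter> T \<subseteq> case_prod Upair ` ?T"
      "openin (prod_topology Y Y) {p \<in> ?T. case_prod Upair p \<in> S \<inter> T}"
      by (auto simp only: openin_Int)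
  next
    fix K assume K: "\<forall>S\<in>K. ?P S"
    then show "\<Union>K \<subseteq> case_prod Upair ` ?T" by blast
    have "{p \<in> ?T. case_prod Upair p \<in> \<Union>K} = \<Union>((\<lambda>S. {p \<in> ?T. case_prod Upair p \<in> S}) ` K)"
      by auto
    then show "openin (prod_topology Y Y) {p \<in> ?T. case_prod Upair p \<in> \<Union>K}"
      using K by (auto simp only: intro!: openin_Union)
  qed
  then show ?thesis
    by (simp only: SP2_def topology_inverse')
qed

lemma topspace_SP2: "topspace (SP2 Y) = case_prod Upair ` topspace (prod_topology Y Y)"
proof -
  have "openin (SP2 Y) (case_prod Upair ` topspace (prod_topology Y Y))"
    unfolding openin_SP2
    by (auto simp: Collect_conj_eq intro!: back_subst[where P = "openin _", OF openin_topspace])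
  moreover have "topspace (SP2 Y) \<subseteq> case_prod Upair ` topspace (prod_topology Y Y)"
    using openin_topspace[of "SP2 Y"] unfolding openin_SP2 by blast
  ultimately show ?thesis
    by (meson openin_subset subset_antisym)
qed

lemma quotient_map_SP2: "quotient_map (prod_topology Y Y) (SP2 Y) (case_prod Upair)"
  unfolding quotient_map_def topspace_SP2 openin_SP2 by auto


section \<open>Absolute neighbourhood retracts\<close>

text \<open>
  HOL cannot quantify over all metrizable spaces, so the ambient spaces range over the metrizable
  topologies on subsets of \<^typ>\<open>'a \<Rightarrow> real\<close>. This loses nothing: a metrizable space \<open>X\<close> embeds as a
  closed subset into a convex subset \<open>L\<close> of the Banach space of bounded continuous functions on \<open>X\<close>
  (Kuratowski--Wojdyslawski), which lives on that type. By Dugundji's extension theorem \<open>L\<close> is an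
  absolute extensor for metrizable spaces, so if \<open>X\<close> is a neighbourhood retract of \<open>L\<close>, it is one
  of every metrizable space containing it as a closed subset. The library predicate \<open>ANR\<close> tests
  only subsets of the original space times the real line, which suffices for Euclidean spaces only.
\<close>

definition ANR_space :: "'a topology \<Rightarrow> bool" where
  "ANR_space X \<longleftrightarrow> metrizable_space X \<and>
     (\<forall>(Z :: ('a \<Rightarrow> real) topology) S.
        metrizable_space Z \<and> closedin Z S \<and> subtopology Z S homeomorphic_space X \<longrightarrow>
        (\<exists>U. openin Z U \<and> S \<subseteq> U \<and> S retract_of_space (subtopology Z U)))"


section \<open>Alexander--Spanier cohomology\<close>

text \<open>
  A \<open>q\<close>-cochain is a function on \<open>(q+1)\<close>-tuples of points of \<open>Y\<close>, tuples being lists; it is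
  extended by zero to all other lists.
\<close>

definition tuples :: "nat \<Rightarrow> 'a topology \<Rightarrow> 'a list set" where
  "tuples q Y = {xs. length xs = Suc q \<and> set xs \<subseteq> topspace Y}"

definition AS_cochains :: "nat \<Rightarrow> 'a topology \<Rightarrow> ('a list \<Rightarrow> 'r::ring_1) set" where
  "AS_cochains q Y = {\<phi>. \<forall>xs. xs \<notin> tuples q Y \<longrightarrow> \<phi> xs = 0}"

definition AS_locally_zero :: "nat \<Rightarrow> 'a topology \<Rightarrow> ('a list \<Rightarrow> 'r::ring_1) set" where
  "AS_locally_zero q Y = {\<phi> \<in> AS_cochains q Y.
     \<exists>\<U>. (\<forall>U\<in>\<U>. openin Y U) \<and> \<Union>\<U> = topspace Y \<and>
         (\<forall>U\<in>\<U>. \<forall>xs\<in>tuples q Y. set xs \<subseteq> U \<longrightarrow> \<phi> xs = 0)}"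

definition omit :: "nat \<Rightarrow> 'a list \<Rightarrow> 'a list" where
  "omit i xs = take i xs @ drop (Suc i) xs"

definition AS_delta :: "nat \<Rightarrow> 'a topology \<Rightarrow> ('a list \<Rightarrow> 'r::ring_1) \<Rightarrow> 'a list \<Rightarrow> 'r" where
  "AS_delta q Y \<phi> = (\<lambda>xs. if xs \<in> tuples (Suc q) Y
     then \<Sum>i\<le>Suc q. (-1) ^ i * \<phi> (omit i xs) else 0)"

text \<open>
  The cohomology of the quotient complex of cochains modulo locally zero cochains is presented as
  cocycles modulo coboundaries, both taken among the cochains themselves: a cocycle is a cochain
  with locally zero coboundary, and a coboundary is \<open>\<delta>\<psi>\<close> plus a locally zero cochain.
\<close>

definition AS_cocycles :: "nat \<Rightarrow> 'a topology \<Rightarrow> ('a list \<Rightarrow> 'r::ring_1) set" where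
  "AS_cocycles q Y = {\<phi> \<in> AS_cochains q Y. AS_delta q Y \<phi> \<in> AS_locally_zero (Suc q) Y}"

definition AS_coboundaries :: "nat \<Rightarrow> 'a topology \<Rightarrow> ('a list \<Rightarrow> 'r::ring_1) set" where
  "AS_coboundaries q Y = (case q of
      0 \<Rightarrow> AS_locally_zero 0 Y
    | Suc p \<Rightarrow> {(\<lambda>xs. AS_delta p Y \<psi> xs + \<zeta> xs) | \<psi> \<zeta>.
                 \<psi> \<in> AS_cochains p Y \<and> \<zeta> \<in> AS_locally_zero (Suc p) Y})"

definition AS_cocycle_group :: "nat \<Rightarrow> 'a topology \<Rightarrow> ('a list \<Rightarrow> 'r::ring_1) monoid" where
  "AS_cocycle_group q Y =
     \<lparr>carrier = AS_cocycles q Y, monoid.mult = (\<lambda>\<phi> \<psi> xs. \<phi> xs + \<psi> xs), one = (\<lambda>_. 0)\<rparr>"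

text \<open>As in HOL-Homology, the additive group is written multiplicatively: its zero is \<open>\<one>\<close>.\<close>

definition AS_cohomology :: "nat \<Rightarrow> 'a topology \<Rightarrow> ('a list \<Rightarrow> 'r::ring_1) set monoid" where
  "AS_cohomology q Y = AS_cocycle_group q Y Mod AS_coboundaries q Y"

definition AS_class :: "nat \<Rightarrow> 'a topology \<Rightarrow> ('a list \<Rightarrow> 'r::ring_1) \<Rightarrow> ('a list \<Rightarrow> 'r) set" where
  "AS_class q Y \<phi> = AS_coboundaries q Y #>\<^bsub>AS_cocycle_group q Y\<^esub> \<phi>"

definition AS_pullback ::
  "nat \<Rightarrow> 'a topology \<Rightarrow> ('a \<Rightarrow> 'b) \<Rightarrow> ('b list \<Rightarrow> 'r::ring_1) \<Rightarrow> 'a list \<Rightarrow> 'r" where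
  "AS_pullback q Y f \<phi> = (\<lambda>xs. if xs \<in> tuples q Y then \<phi> (map f xs) else 0)"

text \<open>
  The homomorphism induced by a continuous map \<open>f\<close> with domain \<open>Y\<close>, and the cup product. The unions
  over representatives only serve to avoid choosing one: all of them give the same class, see
  \<open>AS_induced_class\<close> and \<open>AS_cup_class\<close> below.
\<close>

definition AS_induced ::
  "nat \<Rightarrow> 'a topology \<Rightarrow> ('a \<Rightarrow> 'b) \<Rightarrow> ('b list \<Rightarrow> 'r::ring_1) set \<Rightarrow> ('a list \<Rightarrow> 'r) set" where
  "AS_induced q Y f \<beta> = (\<Union>\<phi>\<in>\<beta>. AS_class q Y (AS_pullback q Y f \<phi>))"

definition AS_cup_cochain :: "nat \<Rightarrow> nat \<Rightarrow> 'a topology \<Rightarrow>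
    ('a list \<Rightarrow> 'r::ring_1) \<Rightarrow> ('a list \<Rightarrow> 'r) \<Rightarrow> 'a list \<Rightarrow> 'r" where
  "AS_cup_cochain p q Y \<phi> \<psi> =
     (\<lambda>xs. if xs \<in> tuples (p + q) Y then \<phi> (take (Suc p) xs) * \<psi> (drop p xs) else 0)"

definition AS_cup :: "nat \<Rightarrow> nat \<Rightarrow> 'a topology \<Rightarrow>
    ('a list \<Rightarrow> 'r::ring_1) set \<Rightarrow> ('a list \<Rightarrow> 'r) set \<Rightarrow> ('a list \<Rightarrow> 'r) set" where
  "AS_cup p q Y \<beta> \<gamma> =
     (\<Union>\<phi>\<in>\<beta>. \<Union>\<psi>\<in>\<gamma>. AS_class (p + q) Y (AS_cup_cochain p q Y \<phi> \<psi>))"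

definition AS_zero_divisor ::
  "nat \<Rightarrow> 'a topology \<Rightarrow> (('a \<times> 'a) list \<Rightarrow> 'r::ring_1) set \<Rightarrow> bool" where
  "AS_zero_divisor k X \<beta> \<longleftrightarrow> \<beta> \<in> carrier (AS_cohomology k (prod_topology X X)) \<and>
     AS_induced k X (\<lambda>x. (x, x)) \<beta> = \<one>\<^bsub>AS_cohomology k X\<^esub>"

lemma AS_locally_zero_iff:
  "\<phi> \<in> AS_locally_zero q Y \<longleftrightarrow> \<phi> \<in> AS_cochains q Y \<and>
     (\<forall>x\<in>topspace Y. \<exists>U. openin Y U \<and> x \<in> U \<and> (\<forall>xs\<in>tuples q Y. set xs \<subseteq> U \<longrightarrow> \<phi> xs = 0))"
  (is "?L \<longleftrightarrow> _ \<and> ?R")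
proof
  assume ?L
  then obtain \<U> where U: "\<phi> \<in> AS_cochains q Y" "\<forall>U\<in>\<U>. openin Y U" "\<Union>\<U> = topspace Y"
         "\<forall>U\<in>\<U>. \<forall>xs\<in>tuples q Y. set xs \<subseteq> U \<longrightarrow> \<phi> xs = 0"
    unfolding AS_locally_zero_def by blast
  then have ?R by (metis UnionE)
  with U show "\<phi> \<in> AS_cochains q Y \<and> ?R" by blast
next
  assume R: "\<phi> \<in> AS_cochains q Y \<and> ?R"
  let ?U = "{U. openin Y U \<and> (\<forall>xs\<in>tuples q Y. set xs \<subseteq> U \<longrightarrow> \<phi> xs = 0)}"
  have "\<Union>?U = topspace Y"
    using R openin_subset by fastforce
  with R show ?L
    unfolding AS_locally_zero_def by (auto intro!: exI[of _ ?U])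
qed

lemma AS_locally_zero_zero: "(\<lambda>_. 0) \<in> AS_locally_zero q Y"
  by (auto simp: AS_locally_zero_iff AS_cochains_def)

lemma AS_locally_zero_add:
  assumes "\<phi> \<in> AS_locally_zero q Y" "\<psi> \<in> AS_locally_zero q Y"
  shows "(\<lambda>xs. \<phi> xs + \<psi> xs) \<in> AS_locally_zero q Y"
  unfolding AS_locally_zero_iff
proof (intro conjI ballI)
  show "(\<lambda>xs. \<phi> xs + \<psi> xs) \<in> AS_cochains q Y"
    using assms by (auto simp: AS_locally_zero_iff AS_cochains_def)
  fix x assume "x \<in> topspace Y"
  then obtain U V where "openin Y U" "x \<in> U" "\<forall>xs\<in>tuples q Y. set xs \<subseteq> U \<longrightarrow> \<phi> xs = 0"
     "openin Y V" "x \<in> V" "\<forall>xs\<in>tuples q Y. set xs \<subseteq> V \<longrightarrow> \<psi> xs = 0"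
    using assms by (metis AS_locally_zero_iff)
  then show "\<exists>U. openin Y U \<and> x \<in> U \<and> (\<forall>xs\<in>tuples q Y. set xs \<subseteq> U \<longrightarrow> \<phi> xs + \<psi> xs = 0)"
    by (intro exI[of _ "U \<inter> V"]) auto
qed

lemma AS_locally_zero_uminus:
  "\<phi> \<in> AS_locally_zero q Y \<Longrightarrow> (\<lambda>xs. - \<phi> xs) \<in> AS_locally_zero q Y"
  by (auto simp: AS_locally_zero_iff AS_cochains_def)

lemma length_omit [simp]: "i < length xs \<Longrightarrow> length (omit i xs) = length xs - 1"
  by (auto simp: omit_def)

lemma set_omit: "set (omit i xs) \<subseteq> set xs"
  using set_take_subset[of i xs] set_drop_subset[of "Suc i" xs] by (auto simp: omit_def)

lemma omit_tuples: "xs \<in> tuples (Suc q) Y \<Longrightarrow> i \<le> Suc q \<Longrightarrow> omit i xs \<in> tuples q Y"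
  using set_omit[of i xs] by (auto simp: tuples_def)

lemma map_omit: "map f (omit i xs) = omit i (map f xs)"
  by (simp add: omit_def take_map drop_map)

lemma omit_nth: "i < length xs \<Longrightarrow> k < length xs - 1 \<Longrightarrow>
    omit i xs ! k = (if k < i then xs ! k else xs ! Suc k)"
  by (auto simp: omit_def nth_append)

lemma omit_omit: "i < j \<Longrightarrow> j < length xs \<Longrightarrow> omit i (omit j xs) = omit (j - 1) (omit i xs)"
  by (intro nth_equalityI) (auto simp: omit_nth)

lemma AS_delta_cochain: "AS_delta q Y \<phi> \<in> AS_cochains (Suc q) Y"
  by (simp add: AS_cochains_def AS_delta_def)

lemma AS_delta_zero: "AS_delta q Y (\<lambda>_. 0) = (\<lambda>_. 0)"
  by (auto simp: AS_delta_def)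

lemma AS_delta_add:
  "AS_delta q Y (\<lambda>xs. \<phi> xs + \<psi> xs) = (\<lambda>xs. AS_delta q Y \<phi> xs + AS_delta q Y \<psi> xs)"
  by (auto simp: AS_delta_def algebra_simps sum.distrib)

lemma AS_delta_uminus: "AS_delta q Y (\<lambda>xs. - \<phi> xs) = (\<lambda>xs. - AS_delta q Y \<phi> xs)"
  by (auto simp: AS_delta_def sum_negf)

lemma AS_delta_locally_zero:
  assumes "\<phi> \<in> AS_locally_zero q Y"
  shows "AS_delta q Y \<phi> \<in> AS_locally_zero (Suc q) Y"
  unfolding AS_locally_zero_iff
proof (intro conjI ballI AS_delta_cochain)
  fix x assume "x \<in> topspace Y"
  then obtain U where U: "openin Y U" "x \<in> U" "\<forall>xs\<in>tuples q Y. set xs \<subseteq> U \<longrightarrow> \<phi> xs = 0"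
    using assms by (metis AS_locally_zero_iff)
  have "AS_delta q Y \<phi> xs = 0" if "xs \<in> tuples (Suc q) Y" "set xs \<subseteq> U" for xs
  proof -
    have "\<phi> (omit i xs) = 0" if "i \<le> Suc q" for i
      using U(3) omit_tuples[OF \<open>xs \<in> _\<close> that] set_omit[of i xs] \<open>set xs \<subseteq> U\<close> by auto
    then show ?thesis
      unfolding AS_delta_def by (simp del: sum.atMost_Suc)
  qed
  with U show "\<exists>U. openin Y U \<and> x \<in> U \<and>
      (\<forall>xs\<in>tuples (Suc q) Y. set xs \<subseteq> U \<longrightarrow> AS_delta q Y \<phi> xs = 0)"
    by blast
qed

lemma AS_delta_delta: "AS_delta (Suc q) Y (AS_delta q Y \<phi>) = (\<lambda>_. 0)"
proof
  fix xs
  show "AS_delta (Suc q) Y (AS_delta q Y \<phi>) xs = 0"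
  proof (cases "xs \<in> tuples (Suc (Suc q)) Y")
    case True
    then have len: "length xs = Suc (Suc (Suc q))" by (simp add: tuples_def)
    define f where "f = (\<lambda>(j, i). (-1) ^ (j + i) * \<phi> (omit i (omit j xs)))"
    let ?P = "{..Suc (Suc q)} \<times> {..Suc q}"
    let ?A = "{(j, i) \<in> ?P. i < j}" and ?B = "{(j, i) \<in> ?P. j \<le> i}"
    have "AS_delta (Suc q) Y (AS_delta q Y \<phi>) xs =
        (\<Sum>j\<le>Suc (Suc q). (-1) ^ j * (\<Sum>i\<le>Suc q. (-1) ^ i * \<phi> (omit i (omit j xs))))"
      using True omit_tuples[OF True] by (auto simp: AS_delta_def intro!: sum.cong simp del: sum.atMost_Suc)
    also have "\<dots> = sum f ?P"
      by (simp add: f_def sum.cartesian_product[symmetric] sum_distrib_left power_add mult.assoc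
          del: sum.atMost_Suc)
    also have "\<dots> = sum f ?A + sum f ?B"
      by (subst sum.union_disjoint[symmetric]) (auto intro!: sum.cong simp del: sum.atMost_Suc
          intro: finite_subset[of _ ?P])
    also have "sum f ?B = sum (\<lambda>p. - f p) ?A"
      by (rule sum.reindex_bij_witness[where i = "\<lambda>(j, i). (i, j - 1)" and j = "\<lambda>(j, i). (Suc i, j)"])
        (auto simp: f_def len omit_omit add.commute)
    finally show ?thesis by (simp add: sum_negf)
  qed (simp add: AS_delta_def)
qed

lemma AS_coboundaries_Suc:
  "\<phi> \<in> AS_coboundaries (Suc q) Y \<longleftrightarrow> (\<exists>\<psi> \<zeta>. \<phi> = (\<lambda>xs. AS_delta q Y \<psi> xs + \<zeta> xs) \<and>
     \<psi> \<in> AS_cochains q Y \<and> \<zeta> \<in> AS_locally_zero (Suc q) Y)"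
  by (auto simp: AS_coboundaries_def)

lemma AS_coboundaries_0: "AS_coboundaries 0 Y = AS_locally_zero 0 Y"
  by (simp add: AS_coboundaries_def)

lemma locally_zero_coboundary: "\<phi> \<in> AS_locally_zero q Y \<Longrightarrow> \<phi> \<in> AS_coboundaries q Y"
proof (cases q)
  case (Suc p)
  assume "\<phi> \<in> AS_locally_zero q Y"
  then show ?thesis unfolding Suc AS_coboundaries_Suc
    by (intro exI[of _ "\<lambda>_. 0"] exI[of _ \<phi>]) (auto simp: AS_delta_def AS_cochains_def)
qed (simp add: AS_coboundaries_0)

lemma delta_coboundary: "\<psi> \<in> AS_cochains q Y \<Longrightarrow> AS_delta q Y \<psi> \<in> AS_coboundaries (Suc q) Y"
  unfolding AS_coboundaries_Suc
  by (intro exI[of _ \<psi>] exI[of _ "\<lambda>_. 0"]) (auto simp: AS_locally_zero_zero)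

lemma coboundary_add:
  assumes "\<phi> \<in> AS_coboundaries q Y" "\<psi> \<in> AS_coboundaries q Y"
  shows "(\<lambda>xs. \<phi> xs + \<psi> xs) \<in> AS_coboundaries q Y"
proof (cases q)
  case (Suc p)
  obtain a b c d where "\<phi> = (\<lambda>xs. AS_delta p Y a xs + b xs)" "a \<in> AS_cochains p Y"
     "b \<in> AS_locally_zero (Suc p) Y" "\<psi> = (\<lambda>xs. AS_delta p Y c xs + d xs)" "c \<in> AS_cochains p Y"
     "d \<in> AS_locally_zero (Suc p) Y"
    using assms unfolding Suc AS_coboundaries_Suc by blast
  then show ?thesis unfolding Suc AS_coboundaries_Suc
    by (intro exI[of _ "\<lambda>xs. a xs + c xs"] exI[of _ "\<lambda>xs. b xs + d xs"])
       (auto simp: AS_delta_add AS_locally_zero_add AS_cochains_def algebra_simps)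
qed (use assms in \<open>simp add: AS_coboundaries_0 AS_locally_zero_add\<close>)

lemma coboundary_uminus:
  assumes "\<phi> \<in> AS_coboundaries q Y"
  shows "(\<lambda>xs. - \<phi> xs) \<in> AS_coboundaries q Y"
proof (cases q)
  case (Suc p)
  obtain a b where "\<phi> = (\<lambda>xs. AS_delta p Y a xs + b xs)" "a \<in> AS_cochains p Y"
     "b \<in> AS_locally_zero (Suc p) Y"
    using assms unfolding Suc AS_coboundaries_Suc by blast
  then show ?thesis unfolding Suc AS_coboundaries_Suc
    by (intro exI[of _ "\<lambda>xs. - a xs"] exI[of _ "\<lambda>xs. - b xs"])
       (auto simp: AS_delta_uminus AS_locally_zero_uminus AS_cochains_def)
qed (use assms in \<open>simp add: AS_coboundaries_0 AS_locally_zero_uminus\<close>)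

lemma coboundaries_subset_cocycles: "AS_coboundaries q Y \<subseteq> AS_cocycles q Y"
proof
  fix \<phi> :: "'a list \<Rightarrow> 'b" assume \<phi>: "\<phi> \<in> AS_coboundaries q Y"
  show "\<phi> \<in> AS_cocycles q Y"
  proof (cases q)
    case 0
    with \<phi> show ?thesis
      by (auto simp: AS_coboundaries_0 AS_cocycles_def AS_delta_locally_zero)
        (simp add: AS_locally_zero_iff)
  next
    case (Suc p)
    obtain a b where ab: "\<phi> = (\<lambda>xs. AS_delta p Y a xs + b xs)" "a \<in> AS_cochains p Y"
     "b \<in> AS_locally_zero (Suc p) Y"
    using \<phi> unfolding Suc AS_coboundaries_Suc by blast
    moreover have "\<phi> \<in> AS_cochains q Y"
      using ab AS_delta_cochain[of p Y a] by (auto simp: Suc AS_cochains_def AS_locally_zero_iff)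
    ultimately show ?thesis
      by (simp add: AS_cocycles_def Suc AS_delta_add AS_delta_delta AS_delta_locally_zero)
  qed
qed

lemma cocycle_add:
  assumes "\<phi> \<in> AS_cocycles q Y" "\<psi> \<in> AS_cocycles q Y"
  shows "(\<lambda>xs. \<phi> xs + \<psi> xs) \<in> AS_cocycles q Y"
  using assms
  by (auto simp: AS_cocycles_def AS_delta_add AS_locally_zero_add) (simp add: AS_cochains_def)

lemma comm_group_AS_cocycle_group: "comm_group (AS_cocycle_group q Y)"
proof (rule comm_groupI)
  show "\<exists>y\<in>carrier (AS_cocycle_group q Y).
          y \<otimes>\<^bsub>AS_cocycle_group q Y\<^esub> x = \<one>\<^bsub>AS_cocycle_group q Y\<^esub>"
    if "x \<in> carrier (AS_cocycle_group q Y)" for x :: "'a list \<Rightarrow> 'b"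
    using that
    by (intro bexI[of _ "\<lambda>xs. - x xs"])
       (auto simp: AS_cocycle_group_def AS_cocycles_def AS_delta_uminus AS_locally_zero_uminus
          AS_cochains_def)
  show "\<one>\<^bsub>AS_cocycle_group q Y\<^esub> \<in> carrier (AS_cocycle_group q Y)"
    by (auto simp: AS_cocycle_group_def AS_cocycles_def AS_delta_zero AS_locally_zero_zero
        AS_cochains_def)
qed (auto simp: AS_cocycle_group_def AS_cocycles_def AS_delta_add AS_locally_zero_add
          AS_cochains_def algebra_simps)

lemma subgroup_AS_coboundaries: "subgroup (AS_coboundaries q Y) (AS_cocycle_group q Y)"
proof -
  interpret comm_group "AS_cocycle_group q Y" by (rule comm_group_AS_cocycle_group)
  have inv: "inv\<^bsub>AS_cocycle_group q Y\<^esub> \<phi> = (\<lambda>xs. - \<phi> xs)"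
    if "\<phi> \<in> AS_coboundaries q Y" for \<phi> :: "'a list \<Rightarrow> 'b"
    using that coboundary_uminus[OF that] coboundaries_subset_cocycles
    by (intro inv_equality) (auto simp: AS_cocycle_group_def)
  show ?thesis
  proof (rule subgroupI)
    show "AS_coboundaries q Y \<noteq> {}"
      using locally_zero_coboundary[OF AS_locally_zero_zero] by blast
  qed (use coboundaries_subset_cocycles inv coboundary_uminus coboundary_add in
      \<open>auto simp: AS_cocycle_group_def\<close>)
qed

lemma AS_coboundaries_normal: "AS_coboundaries q Y \<lhd> AS_cocycle_group q Y"
  by (rule comm_group.normal_iff_subgroup[THEN iffD2, OF comm_group_AS_cocycle_group])
     (rule subgroup_AS_coboundaries)

lemma comm_group_AS_cohomology: "comm_group (AS_cohomology q Y)"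
  unfolding AS_cohomology_def
  by (rule comm_group.abelian_FactGroup[OF comm_group_AS_cocycle_group subgroup_AS_coboundaries])

lemma mem_AS_class:
  "\<psi> \<in> AS_class q Y \<phi> \<longleftrightarrow> (\<lambda>xs. \<psi> xs - \<phi> xs) \<in> AS_coboundaries q Y"
proof -
  have "\<psi> = (\<lambda>xs. b xs + \<phi> xs) \<longleftrightarrow> b = (\<lambda>xs. \<psi> xs - \<phi> xs)" for b
    by (auto simp: fun_eq_iff)
  then show ?thesis
    by (auto simp: AS_class_def r_coset_def AS_cocycle_group_def)
qed

lemma AS_class_eqI:
  assumes "(\<lambda>xs. \<psi> xs - \<phi> xs) \<in> AS_coboundaries q Y"
  shows "AS_class q Y \<psi> = AS_class q Y \<phi>"
proof -
  have "\<rho> \<in> AS_class q Y \<psi> \<longleftrightarrow> \<rho> \<in> AS_class q Y \<phi>" for \<rho>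
    unfolding mem_AS_class
    using coboundary_add[OF assms, of "\<lambda>xs. \<rho> xs - \<psi> xs"]
      coboundary_add[OF coboundary_uminus[OF assms], of "\<lambda>xs. \<rho> xs - \<phi> xs"]
    by (auto simp: algebra_simps)
  then show ?thesis by blast
qed

lemma AS_class_self: "\<phi> \<in> AS_class q Y \<phi>"
  using locally_zero_coboundary[OF AS_locally_zero_zero] by (simp add: mem_AS_class)

lemma carrier_AS_cohomology: "carrier (AS_cohomology q Y) = AS_class q Y ` AS_cocycles q Y"
  by (auto simp: AS_cohomology_def FactGroup_def RCOSETS_def AS_class_def AS_cocycle_group_def)

lemma one_AS_cohomology: "\<one>\<^bsub>AS_cohomology q Y\<^esub> = AS_class q Y (\<lambda>_. 0)"
  by (auto simp: AS_cohomology_def mem_AS_class)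

lemma map_tuples:
  "continuous_map X Y f \<Longrightarrow> xs \<in> tuples q X \<Longrightarrow> map f xs \<in> tuples q Y"
  using continuous_map_image_subset_topspace by (fastforce simp: tuples_def)

lemma AS_pullback_locally_zero:
  assumes f: "continuous_map X Y f" and \<phi>: "\<phi> \<in> AS_locally_zero q Y"
  shows "AS_pullback q X f \<phi> \<in> AS_locally_zero q X"
  unfolding AS_locally_zero_iff
proof (intro conjI ballI)
  show "AS_pullback q X f \<phi> \<in> AS_cochains q X"
    by (auto simp: AS_pullback_def AS_cochains_def)
  fix x assume x: "x \<in> topspace X"
  then have "f x \<in> topspace Y"
    using f continuous_map_image_subset_topspace by fastforce
  then obtain U where U: "openin Y U" "f x \<in> U" "\<forall>xs\<in>tuples q Y. set xs \<subseteq> U \<longrightarrow> \<phi> xs = 0"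
    using \<phi> by (metis AS_locally_zero_iff)
  have "openin X {x \<in> topspace X. f x \<in> U}"
    using U f openin_continuous_map_preimage by blast
  then show "\<exists>V. openin X V \<and> x \<in> V \<and>
      (\<forall>xs\<in>tuples q X. set xs \<subseteq> V \<longrightarrow> AS_pullback q X f \<phi> xs = 0)"
    using U x map_tuples[OF f]
    by (intro exI[of _ "{x \<in> topspace X. f x \<in> U}"]) (force simp: AS_pullback_def)
qed

lemma AS_pullback_delta:
  assumes f: "continuous_map X Y f"
  shows "AS_delta q X (AS_pullback q X f \<phi>) = AS_pullback (Suc q) X f (AS_delta q Y \<phi>)"
  using map_tuples[OF f]
  by (auto simp: AS_delta_def AS_pullback_def map_omit omit_tuples intro!: sum.cong
     simp del: sum.atMost_Suc)

lemma AS_pullback_cocycle: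
  assumes f: "continuous_map X Y f" and \<phi>: "\<phi> \<in> AS_cocycles q Y"
  shows "AS_pullback q X f \<phi> \<in> AS_cocycles q X"
proof -
  have "AS_pullback q X f \<phi> \<in> AS_cochains q X"
    by (simp add: AS_pullback_def AS_cochains_def)
  with \<phi> show ?thesis
    by (simp add: AS_cocycles_def AS_pullback_delta[OF f] AS_pullback_locally_zero[OF f])
qed

lemma AS_pullback_coboundary:
  assumes f: "continuous_map X Y f" and \<phi>: "\<phi> \<in> AS_coboundaries q Y"
  shows "AS_pullback q X f \<phi> \<in> AS_coboundaries q X"
proof (cases q)
  case (Suc p)
  obtain a b where ab: "\<phi> = (\<lambda>xs. AS_delta p Y a xs + b xs)" "a \<in> AS_cochains p Y"
     "b \<in> AS_locally_zero (Suc p) Y"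
    using \<phi> unfolding Suc AS_coboundaries_Suc by blast
  have "AS_pullback q X f \<phi> =
      (\<lambda>xs. AS_pullback q X f (AS_delta p Y a) xs + AS_pullback q X f b xs)"
    by (auto simp: ab AS_pullback_def)
  also have "\<dots> = (\<lambda>xs. AS_delta p X (AS_pullback p X f a) xs + AS_pullback q X f b xs)"
    by (simp add: AS_pullback_delta[OF f] Suc)
  also have "\<dots> \<in> AS_coboundaries q X"
    unfolding Suc using ab(3)
    by (intro coboundary_add delta_coboundary locally_zero_coboundary AS_pullback_locally_zero[OF f])
       (auto simp: AS_cochains_def AS_pullback_def)
  finally show ?thesis .
qed (use \<phi> AS_pullback_locally_zero[OF f] in \<open>auto simp: AS_coboundaries_0\<close>)

lemma AS_induced_class:
  assumes f: "continuous_map X Y f"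
  shows "AS_induced q X f (AS_class q Y \<phi>) = AS_class q X (AS_pullback q X f \<phi>)"
proof -
  have "AS_class q X (AS_pullback q X f \<psi>) = AS_class q X (AS_pullback q X f \<phi>)"
    if "\<psi> \<in> AS_class q Y \<phi>" for \<psi>
  proof (rule AS_class_eqI)
    have "(\<lambda>xs. AS_pullback q X f \<psi> xs - AS_pullback q X f \<phi> xs) =
        AS_pullback q X f (\<lambda>xs. \<psi> xs - \<phi> xs)"
      by (auto simp: AS_pullback_def)
    then show "(\<lambda>xs. AS_pullback q X f \<psi> xs - AS_pullback q X f \<phi> xs) \<in> AS_coboundaries q X"
      using AS_pullback_coboundary[OF f] that by (simp add: mem_AS_class)
  qed
  then show ?thesis
    using AS_class_self[of \<phi> q Y] unfolding AS_induced_def by blast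
qed

lemma AS_cup_cochain_in: "AS_cup_cochain p q Y \<phi> \<psi> \<in> AS_cochains (p + q) Y"
  by (auto simp: AS_cup_cochain_def AS_cochains_def)

lemma take_drop_tuples:
  assumes "xs \<in> tuples (p + q) Y"
  shows "take (Suc p) xs \<in> tuples p Y" "drop p xs \<in> tuples q Y"
  using assms set_take_subset[of "Suc p" xs] set_drop_subset[of p xs] by (auto simp: tuples_def)

lemma AS_cup_cochain_locally_zero:
  assumes "\<phi> \<in> AS_locally_zero p Y \<or> \<psi> \<in> AS_locally_zero q Y"
  shows "AS_cup_cochain p q Y \<phi> \<psi> \<in> AS_locally_zero (p + q) Y"
  unfolding AS_locally_zero_iff
proof (intro conjI ballI AS_cup_cochain_in)
  fix x assume x: "x \<in> topspace Y"
  then obtain U where U: "openin Y U" "x \<in> U" "(\<forall>xs\<in>tuples p Y. set xs \<subseteq> U \<longrightarrow> \<phi> xs = 0) \<or>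
      (\<forall>xs\<in>tuples q Y. set xs \<subseteq> U \<longrightarrow> \<psi> xs = 0)"
    using assms by (metis AS_locally_zero_iff)
  have "AS_cup_cochain p q Y \<phi> \<psi> xs = 0" if "xs \<in> tuples (p + q) Y" "set xs \<subseteq> U" for xs
    using U(3) take_drop_tuples[OF that(1)] that(2) set_take_subset[of "Suc p" xs]
      set_drop_subset[of p xs]
    by (auto simp: AS_cup_cochain_def)
  with U show "\<exists>U. openin Y U \<and> x \<in> U \<and>
      (\<forall>xs\<in>tuples (p + q) Y. set xs \<subseteq> U \<longrightarrow> AS_cup_cochain p q Y \<phi> \<psi> xs = 0)"
    by blast
qed

lemma take_drop_omit:
  assumes "i < length xs"
  shows "i \<le> p \<Longrightarrow> take (Suc p) (omit i xs) = omit i (take (Suc (Suc p)) xs)"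
    and "i \<le> p \<Longrightarrow> drop p (omit i xs) = drop (Suc p) xs"
    and "p < i \<Longrightarrow> take (Suc p) (omit i xs) = take (Suc p) xs"
    and "p < i \<Longrightarrow> drop p (omit i xs) = omit (i - p) (drop p xs)"
  using assms by (auto simp: omit_def take_drop min_def Suc_diff_le)

lemma AS_delta_cup:
  fixes \<phi> \<psi> :: "'a list \<Rightarrow> 'r::ring_1"
  shows "AS_delta (p + q) Y (AS_cup_cochain p q Y \<phi> \<psi>) =
     (\<lambda>xs. AS_cup_cochain (Suc p) q Y (AS_delta p Y \<phi>) \<psi> xs +
           (-1) ^ p * AS_cup_cochain p (Suc q) Y \<phi> (AS_delta q Y \<psi>) xs)"
proof
  fix xs :: "'a list"
  show "AS_delta (p + q) Y (AS_cup_cochain p q Y \<phi> \<psi>) xs =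
      AS_cup_cochain (Suc p) q Y (AS_delta p Y \<phi>) \<psi> xs +
           (-1) ^ p * AS_cup_cochain p (Suc q) Y \<phi> (AS_delta q Y \<psi>) xs"
  proof (cases "xs \<in> tuples (Suc (p + q)) Y")
    case True
    then have len: "length xs = Suc (Suc (p + q))" by (simp add: tuples_def)
    define g where "g i = (-1) ^ i * (\<phi> (take (Suc p) (omit i xs)) * \<psi> (drop p (omit i xs)))" for i
    define a where "a i = (-1) ^ i * (\<phi> (omit i (take (Suc (Suc p)) xs)) * \<psi> (drop (Suc p) xs))" for i
    define b where "b i = (-1) ^ (p + i) * (\<phi> (take (Suc p) xs) * \<psi> (omit i (drop p xs)))" for i
    have comm: "\<phi> us * ((-1) ^ i * \<psi> vs) = (-1) ^ i * (\<phi> us * \<psi> vs)" for us vs i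
      by (cases "even i") auto
    have 1: "AS_delta (p + q) Y (AS_cup_cochain p q Y \<phi> \<psi>) xs = sum g {..Suc (p + q)}"
      using True omit_tuples[OF True]
      by (auto simp: AS_delta_def AS_cup_cochain_def g_def intro!: sum.cong simp del: sum.atMost_Suc)
    have "{..Suc (p + q)} = {..p} \<union> {Suc p..Suc (p + q)}" by auto
    then have "sum g {..Suc (p + q)} = sum g {..p} + sum g {Suc p..Suc (p + q)}"
      by (simp only:) (rule sum.union_disjoint; auto)
    also have "sum g {..p} = sum a {..p}"
      by (intro sum.cong) (auto simp: g_def a_def take_drop_omit len)
    also have "sum g {Suc p..Suc (p + q)} = sum b {Suc 0..Suc q}"
      by (rule sum.reindex_bij_witness[where i = "\<lambda>i. i + p" and j = "\<lambda>i. i - p"])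
         (auto simp: g_def b_def take_drop_omit len)
    finally have 2: "sum g {..Suc (p + q)} = sum a {..p} + sum b {Suc 0..Suc q}" .
    have 3: "AS_cup_cochain (Suc p) q Y (AS_delta p Y \<phi>) \<psi> xs = sum a {..Suc p}"
      using True take_drop_tuples(1)[of xs "Suc p" q Y]
      by (auto simp: AS_delta_def AS_cup_cochain_def a_def sum_distrib_right mult.assoc
          simp del: sum.atMost_Suc)
    have 4: "(-1) ^ p * AS_cup_cochain p (Suc q) Y \<phi> (AS_delta q Y \<psi>) xs = sum b {..Suc q}"
      using True take_drop_tuples(2)[of xs p "Suc q" Y]
      by (auto simp: AS_delta_def AS_cup_cochain_def b_def sum_distrib_left power_add mult.assoc comm
          simp del: sum.atMost_Suc)
    have "{..Suc q} = insert 0 {Suc 0..Suc q}" by auto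
    then have 5: "sum b {..Suc q} = b 0 + sum b {Suc 0..Suc q}" by simp
    have "omit (Suc p) (take (Suc (Suc p)) xs) = take (Suc p) xs"
      "omit 0 (drop p xs) = drop (Suc p) xs"
      by (auto simp: omit_def min_def)
    then have "a (Suc p) = - b 0"
      by (simp add: a_def b_def)
    then have "sum a {..Suc p} + sum b {..Suc q} = sum a {..p} + sum b {Suc 0..Suc q}"
      unfolding 5 by simp
    with 1 2 3 4 show ?thesis by simp
  qed (auto simp: AS_delta_def AS_cup_cochain_def)
qed

lemma AS_sign_locally_zero:
  "\<phi> \<in> AS_locally_zero q Y \<Longrightarrow> (\<lambda>xs. (-1) ^ p * \<phi> xs) \<in> AS_locally_zero q Y"
  by (cases "even p") (simp_all add: AS_locally_zero_uminus)

lemma AS_cup_cocycle: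
  assumes "\<phi> \<in> AS_cocycles p Y" "\<psi> \<in> AS_cocycles q Y"
  shows "AS_cup_cochain p q Y \<phi> \<psi> \<in> AS_cocycles (p + q) Y"
proof -
  have "AS_cup_cochain (Suc p) q Y (AS_delta p Y \<phi>) \<psi> \<in> AS_locally_zero (Suc (p + q)) Y"
    "AS_cup_cochain p (Suc q) Y \<phi> (AS_delta q Y \<psi>) \<in> AS_locally_zero (Suc (p + q)) Y"
    using assms AS_cup_cochain_locally_zero[of "AS_delta p Y \<phi>" "Suc p" Y \<psi> q]
      AS_cup_cochain_locally_zero[of \<phi> p Y "AS_delta q Y \<psi>" "Suc q"]
    by (simp_all add: AS_cocycles_def)
  then show ?thesis
    by (simp add: AS_cocycles_def AS_cup_cochain_in AS_delta_cup AS_locally_zero_add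
        AS_sign_locally_zero)
qed

lemma AS_cup_coboundary_left:
  assumes "\<phi> \<in> AS_coboundaries p Y" "\<psi> \<in> AS_cocycles q Y"
  shows "AS_cup_cochain p q Y \<phi> \<psi> \<in> AS_coboundaries (p + q) Y"
proof (cases p)
  case 0
  then show ?thesis
    using assms by (intro locally_zero_coboundary AS_cup_cochain_locally_zero)
      (auto simp: AS_coboundaries_0)
next
  case (Suc n)
  obtain a b where ab: "\<phi> = (\<lambda>xs. AS_delta n Y a xs + b xs)" "a \<in> AS_cochains n Y"
     "b \<in> AS_locally_zero (Suc n) Y"
    using assms(1) unfolding Suc AS_coboundaries_Suc by blast
  let ?c = "AS_cup_cochain n (Suc q) Y a (AS_delta q Y \<psi>)"
  have c: "?c \<in> AS_locally_zero (Suc (n + q)) Y"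
    using assms(2) AS_cup_cochain_locally_zero[of a n Y "AS_delta q Y \<psi>" "Suc q"]
    by (auto simp: AS_cocycles_def)
  have "AS_cup_cochain p q Y \<phi> \<psi> = (\<lambda>xs. AS_cup_cochain (Suc n) q Y (AS_delta n Y a) \<psi> xs +
      AS_cup_cochain (Suc n) q Y b \<psi> xs)"
    by (auto simp: ab Suc AS_cup_cochain_def algebra_simps)
  also have "\<dots> = (\<lambda>xs. AS_delta (n + q) Y (AS_cup_cochain n q Y a \<psi>) xs +
      (- ((-1) ^ n * ?c xs) + AS_cup_cochain (Suc n) q Y b \<psi> xs))"
    by (simp add: AS_delta_cup)
  also have "\<dots> \<in> AS_coboundaries (Suc (n + q)) Y"
    using c ab(3) AS_cup_cochain_locally_zero[of b "Suc n" Y \<psi> q]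
    by (intro coboundary_add delta_coboundary AS_cup_cochain_in locally_zero_coboundary
        AS_locally_zero_uminus AS_sign_locally_zero) auto
  finally show ?thesis by (simp add: Suc)
qed

lemma AS_cup_coboundary_right:
  assumes "\<phi> \<in> AS_cocycles p Y" "\<psi> \<in> AS_coboundaries q Y"
  shows "AS_cup_cochain p q Y \<phi> \<psi> \<in> AS_coboundaries (p + q) Y"
proof (cases q)
  case 0
  then show ?thesis
    using assms by (intro locally_zero_coboundary AS_cup_cochain_locally_zero)
      (auto simp: AS_coboundaries_0)
next
  case (Suc n)
  obtain a b where ab: "\<psi> = (\<lambda>xs. AS_delta n Y a xs + b xs)" "a \<in> AS_cochains n Y"
     "b \<in> AS_locally_zero (Suc n) Y"
    using assms(2) unfolding Suc AS_coboundaries_Suc by blast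
  let ?c = "AS_cup_cochain (Suc p) n Y (AS_delta p Y \<phi>) a"
  have c: "?c \<in> AS_locally_zero (Suc (p + n)) Y"
    using assms(1) AS_cup_cochain_locally_zero[of "AS_delta p Y \<phi>" "Suc p" Y a n]
    by (auto simp: AS_cocycles_def)
  have sign: "(\<lambda>xs. (-1) ^ p * \<kappa> xs) \<in> AS_coboundaries k Y"
    if "\<kappa> \<in> AS_coboundaries k Y" for \<kappa> :: "'a list \<Rightarrow> 'b" and k
    using that by (cases "even p") (auto intro: coboundary_uminus)
  have sq: "(-1) ^ p * ((-1) ^ p * r) = r" for r :: 'b
    by (cases "even p") auto
  have "AS_cup_cochain p q Y \<phi> \<psi> = (\<lambda>xs. AS_cup_cochain p (Suc n) Y \<phi> (AS_delta n Y a) xs +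
      AS_cup_cochain p (Suc n) Y \<phi> b xs)"
    by (auto simp: ab Suc AS_cup_cochain_def algebra_simps)
  also have "\<dots> = (\<lambda>xs. (-1) ^ p * (AS_delta (p + n) Y (AS_cup_cochain p n Y \<phi> a) xs + - ?c xs)
      + AS_cup_cochain p (Suc n) Y \<phi> b xs)"
    by (simp add: AS_delta_cup sq)
  also have "\<dots> \<in> AS_coboundaries (Suc (p + n)) Y"
    using c ab(3) AS_cup_cochain_locally_zero[of \<phi> p Y b "Suc n"]
    by (intro coboundary_add sign delta_coboundary AS_cup_cochain_in locally_zero_coboundary
        AS_locally_zero_uminus) auto
  finally show ?thesis by (simp add: Suc)
qed

lemma AS_cup_class:
  assumes "\<phi> \<in> AS_cocycles p Y" "\<psi> \<in> AS_cocycles q Y"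
  shows "AS_cup p q Y (AS_class p Y \<phi>) (AS_class q Y \<psi>) =
         AS_class (p + q) Y (AS_cup_cochain p q Y \<phi> \<psi>)"
proof -
  have "AS_class (p + q) Y (AS_cup_cochain p q Y \<phi>' \<psi>') =
      AS_class (p + q) Y (AS_cup_cochain p q Y \<phi> \<psi>)"
    if "\<phi>' \<in> AS_class p Y \<phi>" "\<psi>' \<in> AS_class q Y \<psi>" for \<phi>' \<psi>'
  proof (rule AS_class_eqI)
    have b: "(\<lambda>xs. \<phi>' xs - \<phi> xs) \<in> AS_coboundaries p Y" "(\<lambda>xs. \<psi>' xs - \<psi> xs) \<in> AS_coboundaries q Y"
      using that by (auto simp: mem_AS_class)
    have "(\<lambda>xs. \<psi> xs + (\<psi>' xs - \<psi> xs)) \<in> AS_cocycles q Y"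
      using assms(2) b(2) coboundaries_subset_cocycles by (intro cocycle_add) auto
    then have "\<psi>' \<in> AS_cocycles q Y" by simp
    then have "(\<lambda>xs. AS_cup_cochain p q Y (\<lambda>xs. \<phi>' xs - \<phi> xs) \<psi>' xs +
         AS_cup_cochain p q Y \<phi> (\<lambda>xs. \<psi>' xs - \<psi> xs) xs) \<in> AS_coboundaries (p + q) Y"
      using b assms by (intro coboundary_add AS_cup_coboundary_left AS_cup_coboundary_right)
    also have "(\<lambda>xs. AS_cup_cochain p q Y (\<lambda>xs. \<phi>' xs - \<phi> xs) \<psi>' xs +
         AS_cup_cochain p q Y \<phi> (\<lambda>xs. \<psi>' xs - \<psi> xs) xs) =
         (\<lambda>xs. AS_cup_cochain p q Y \<phi>' \<psi>' xs - AS_cup_cochain p q Y \<phi> \<psi> xs)"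
      by (auto simp: AS_cup_cochain_def algebra_simps)
    finally show "(\<lambda>xs. AS_cup_cochain p q Y \<phi>' \<psi>' xs - AS_cup_cochain p q Y \<phi> \<psi> xs)
        \<in> AS_coboundaries (p + q) Y" .
  qed
  then show ?thesis
    using AS_class_self[of \<phi> p Y] AS_class_self[of \<psi> q Y] unfolding AS_cup_def by blast
qed


section \<open>Finitely supported measures and resolvable paths\<close>

text \<open>
  Probability measures with finite support are represented by \<^typ>\<open>'a pmf\<close>, the Dirac measures
  being \<^term>\<open>return_pmf\<close>.
\<close>

definition fin_measures :: "nat \<Rightarrow> 'a set \<Rightarrow> 'a pmf set" where
  "fin_measures n S = {\<mu>. set_pmf \<mu> \<subseteq> S \<and> finite (set_pmf \<mu>) \<and> card (set_pmf \<mu>) \<le> n}"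

definition metric_nbhd :: "'a metric \<Rightarrow> 'a set \<Rightarrow> real \<Rightarrow> 'a set" where
  "metric_nbhd m A e = {y \<in> mspace m. \<exists>x\<in>A. mdist m x y < e}"

definition LP_good :: "'a metric \<Rightarrow> 'a pmf \<Rightarrow> 'a pmf \<Rightarrow> real \<Rightarrow> bool" where
  "LP_good m \<mu> \<nu> e \<longleftrightarrow> e > 0 \<and>
     (\<forall>A \<in> sigma_sets (mspace m) {U. openin (mtopology_of m) U}.
        measure_pmf.prob \<mu> A \<le> measure_pmf.prob \<nu> (metric_nbhd m A e) + e \<and>
        measure_pmf.prob \<nu> A \<le> measure_pmf.prob \<mu> (metric_nbhd m A e) + e)"

definition LP_dist :: "'a metric \<Rightarrow> 'a pmf \<Rightarrow> 'a pmf \<Rightarrow> real" where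
  "LP_dist m \<mu> \<nu> = Inf {e. LP_good m \<mu> \<nu> e}"

definition fin_measures_metric :: "nat \<Rightarrow> 'a metric \<Rightarrow> 'a pmf metric" where
  "fin_measures_metric n m = metric (fin_measures n (mspace m), LP_dist m)"

text \<open>
  Paths are made extensional on the unit interval, so that they are determined by their
  restriction to it.
\<close>

definition paths :: "'a topology \<Rightarrow> (real \<Rightarrow> 'a) set" where
  "paths Z = {g \<in> extensional {0..1}. pathin Z g}"

definition path_topology :: "'a topology \<Rightarrow> (real \<Rightarrow> 'a) topology" where
  "path_topology Z = topology_generated_by
     {{g \<in> paths Z. g ` K \<subseteq> U} | K U. compact K \<and> K \<subseteq> {0..1} \<and> openin Z U}"

text \<open>The map sending a measure on paths to a path of measures.\<close>

definition measure_path :: "(real \<Rightarrow> 'a) pmf \<Rightarrow> real \<Rightarrow> 'a pmf" where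
  "measure_path \<mu> = (\<lambda>t\<in>{0..1}. map_pmf (\<lambda>\<alpha>. \<alpha> t) \<mu>)"

definition resolvable_paths :: "nat \<Rightarrow> 'a metric \<Rightarrow> (real \<Rightarrow> 'a pmf) set" where
  "resolvable_paths n m = measure_path ` fin_measures n (paths (mtopology_of m))"

definition RP :: "nat \<Rightarrow> 'a metric \<Rightarrow> (real \<Rightarrow> 'a pmf) topology" where
  "RP n m = subtopology (path_topology (mtopology_of (fin_measures_metric n m)))
     (resolvable_paths n m)"

definition iTC :: "'a metric \<Rightarrow> enat" where
  "iTC m = Inf {enat n | n. \<exists>s.
     continuous_map (prod_topology (mtopology_of m) (mtopology_of m)) (RP (Suc n) m) s \<and>
     (\<forall>x\<in>mspace m. \<forall>y\<in>mspace m.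
        s (x, y) 0 = return_pmf x \<and> s (x, y) 1 = return_pmf y)}"

lemma borel_subset_mspace:
  assumes "A \<in> sigma_sets (mspace m) {U. openin (mtopology_of m) U}"
  shows "A \<subseteq> mspace m"
proof (rule sigma_sets_into_sp[OF _ assms])
  show "{U. openin (mtopology_of m) U} \<subseteq> Pow (mspace m)"
    using openin_subset[of "mtopology_of m"] by auto
qed

lemma metric_nbhd_borel:
  assumes "A \<subseteq> mspace m"
  shows "metric_nbhd m A e \<in> sigma_sets (mspace m) {U. openin (mtopology_of m) U}"
proof -
  interpret Metric_space "mspace m" "mdist m" by simp
  have "metric_nbhd m A e = (\<Union>x\<in>A. mball x e)"
    using assms unfolding metric_nbhd_def mball_def by blast
  then have "openin (mtopology_of m) (metric_nbhd m A e)"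
    by (auto simp: mtopology_of_def)
  then show ?thesis by auto
qed

lemma metric_nbhd_nbhd:
  assumes "A \<subseteq> mspace m"
  shows "metric_nbhd m (metric_nbhd m A e) d \<subseteq> metric_nbhd m A (e + d)"
proof
  fix z assume "z \<in> metric_nbhd m (metric_nbhd m A e) d"
  then obtain y x where *: "z \<in> mspace m" "y \<in> mspace m" "x \<in> A" "mdist m x y < e" "mdist m y z < d"
    by (auto simp: metric_nbhd_def)
  then have "mdist m x z < e + d"
    using mdist_triangle[of x m y z] assms by fastforce
  with * show "z \<in> metric_nbhd m A (e + d)"
    by (auto simp: metric_nbhd_def)
qed

lemma metric_nbhd_mono: "e \<le> e' \<Longrightarrow> metric_nbhd m A e \<subseteq> metric_nbhd m A e'"
  unfolding metric_nbhd_def using less_le_trans by fast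

lemma metric_nbhd_superset: "A \<subseteq> mspace m \<Longrightarrow> e > 0 \<Longrightarrow> A \<subseteq> metric_nbhd m A e"
proof
  fix x assume A: "A \<subseteq> mspace m" "e > 0" and x: "x \<in> A"
  then have "x \<in> mspace m" by blast
  moreover from this have "mdist m x x = 0" by simp
  moreover from this have "mdist m x x < e" using A(2) by linarith
  ultimately show "x \<in> metric_nbhd m A e" using x unfolding metric_nbhd_def by blast
qed

lemma LP_good_commute: "LP_good m \<mu> \<nu> e \<longleftrightarrow> LP_good m \<nu> \<mu> e"
  unfolding LP_good_def by blast

lemma LP_good_nonempty: "LP_good m \<mu> \<nu> 1"
  unfolding LP_good_def by (simp add: add_increasing measure_pmf.prob_le_1)

lemma LP_good_bdd: "bdd_below {e. LP_good m \<mu> \<nu> e}"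
  by (rule bdd_belowI[of _ 0]) (auto simp: LP_good_def)

lemma LP_dist_le: "LP_good m \<mu> \<nu> e \<Longrightarrow> LP_dist m \<mu> \<nu> \<le> e"
  unfolding LP_dist_def by (rule cInf_lower) (auto simp: LP_good_bdd)

lemma LP_good_mono:
  assumes "LP_good m \<mu> \<nu> e" "e \<le> e'"
  shows "LP_good m \<mu> \<nu> e'"
proof -
  have "measure_pmf.prob \<rho> (metric_nbhd m A e) \<le> measure_pmf.prob \<rho> (metric_nbhd m A e')" for \<rho> A
    by (intro measure_pmf.finite_measure_mono metric_nbhd_mono assms(2)) simp
  with assms show ?thesis
    unfolding LP_good_def by (meson add_mono order_less_le_trans order_trans)
qed

lemma LP_dist_less: 
  assumes "LP_dist m \<mu> \<nu> < e"
  shows "LP_good m \<mu> \<nu> e"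
proof -
  obtain d where "LP_good m \<mu> \<nu> d" "d < e"
    using assms cInf_lessD[of "{e. LP_good m \<mu> \<nu> e}" e] LP_good_nonempty
    unfolding LP_dist_def by blast
  then show ?thesis by (meson LP_good_mono less_imp_le)
qed

lemma LP_dist_nonneg: "0 \<le> LP_dist m \<mu> \<nu>"
  unfolding LP_dist_def
proof (rule cInf_greatest)
  show "{e. LP_good m \<mu> \<nu> e} \<noteq> {}" using LP_good_nonempty by blast
qed (simp add: LP_good_def)

lemma LP_good_trans:
  assumes "LP_good m \<mu> \<nu> e" "LP_good m \<nu> \<rho> d"
  shows "LP_good m \<mu> \<rho> (e + d)"
proof -
  have *: "measure_pmf.prob \<mu> A \<le> measure_pmf.prob \<rho> (metric_nbhd m A (e + d)) + (e + d)"
    if "LP_good m \<mu> \<nu> e" "LP_good m \<nu> \<rho> d"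
      "A \<in> sigma_sets (mspace m) {U. openin (mtopology_of m) U}" for \<mu> \<nu> \<rho> A e d
  proof -
    have A: "A \<subseteq> mspace m" using that borel_subset_mspace by blast
    have "measure_pmf.prob \<mu> A \<le> measure_pmf.prob \<nu> (metric_nbhd m A e) + e"
      using that by (simp add: LP_good_def)
    also have "measure_pmf.prob \<nu> (metric_nbhd m A e) \<le>
        measure_pmf.prob \<rho> (metric_nbhd m (metric_nbhd m A e) d) + d"
      using that(2) metric_nbhd_borel[OF A] unfolding LP_good_def by blast
    also have "measure_pmf.prob \<rho> (metric_nbhd m (metric_nbhd m A e) d) \<le>
        measure_pmf.prob \<rho> (metric_nbhd m A (e + d))"
      by (intro measure_pmf.finite_measure_mono metric_nbhd_nbhd A) auto
    finally show ?thesis by simp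
  qed
  show ?thesis
    unfolding LP_good_def
  proof (intro conjI ballI)
    show "0 < e + d" using assms by (simp add: LP_good_def)
    fix A assume A: "A \<in> sigma_sets (mspace m) {U. openin (mtopology_of m) U}"
    show "measure_pmf.prob \<mu> A \<le> measure_pmf.prob \<rho> (metric_nbhd m A (e + d)) + (e + d)"
      by (rule *[OF assms A])
    have "LP_good m \<rho> \<nu> d" "LP_good m \<nu> \<mu> e" using assms LP_good_commute by blast+
    from *[OF this A]
    show "measure_pmf.prob \<rho> A \<le> measure_pmf.prob \<mu> (metric_nbhd m A (e + d)) + (e + d)"
      by (simp only: add.commute[of d e])
  qed
qed

lemma LP_zero_imp_le:
  assumes "finite (set_pmf \<nu>)" "set_pmf \<nu> \<subseteq> mspace m" "x \<in> mspace m" "LP_dist m \<mu> \<nu> = 0"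
  shows "pmf \<mu> x \<le> pmf \<nu> x"
proof (rule field_le_epsilon)
  fix e :: real assume "e > 0"
  define D where "D = insert e (mdist m x ` (set_pmf \<nu> - {x}))"
  have D: "finite D" "D \<noteq> {}" "\<And>d. d \<in> D \<Longrightarrow> d > 0"
    using assms \<open>e > 0\<close> mdist_zero[of x m]
    by (auto simp: D_def less_le)
  define d where "d = Min D"
  have d: "d > 0" "d \<le> e" "\<And>y. y \<in> set_pmf \<nu> \<Longrightarrow> y \<noteq> x \<Longrightarrow> d \<le> mdist m x y"
    using D by (auto simp: d_def D_def)
  have good: "LP_good m \<mu> \<nu> d"
    using d assms by (intro LP_dist_less) simp
  have "closedin (mtopology_of m) {x}"
    using assms(3) by (intro closedin_Hausdorff_singleton)
      (simp_all add: mtopology_of_def Metric_space.Hausdorff_space_mtopology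
        Metric_space.topspace_mtopology)
  then have "mspace m - (mspace m - {x}) \<in> sigma_sets (mspace m) {U. openin (mtopology_of m) U}"
    by (intro sigma_sets.Compl sigma_sets.Basic) (simp add: closedin_def)
  moreover have "mspace m - (mspace m - {x}) = {x}" using assms by auto
  ultimately have "measure_pmf.prob \<mu> {x} \<le> measure_pmf.prob \<nu> (metric_nbhd m {x} d) + d"
    using good by (auto simp: LP_good_def)
  also have "measure_pmf.prob \<nu> (metric_nbhd m {x} d) =
      measure_pmf.prob \<nu> (metric_nbhd m {x} d \<inter> set_pmf \<nu>)"
    by (simp add: measure_Int_set_pmf)
  also have "\<dots> \<le> measure_pmf.prob \<nu> {x}"
    using d by (intro measure_pmf.finite_measure_mono) (force simp: metric_nbhd_def)+
  finally show "pmf \<mu> x \<le> pmf \<nu> x + e"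
    using d by (simp add: measure_pmf_single)
qed

lemma LP_refl: "LP_dist m \<mu> \<mu> = 0"
proof -
  have "LP_good m \<mu> \<mu> e" if "e > 0" for e
  proof -
    have "measure_pmf.prob \<mu> A \<le> measure_pmf.prob \<mu> (metric_nbhd m A e)"
      if "A \<in> sigma_sets (mspace m) {U. openin (mtopology_of m) U}" for A
      using metric_nbhd_superset[OF borel_subset_mspace[OF that] \<open>e > 0\<close>]
      by (intro measure_pmf.finite_measure_mono) auto
    with that show ?thesis by (auto simp: LP_good_def intro: add_increasing2)
  qed
  then have "LP_dist m \<mu> \<mu> \<le> 0 + e" if "e > 0" for e
    using that LP_dist_le by fastforce
  then have "LP_dist m \<mu> \<mu> \<le> 0"
    by (rule field_le_epsilon)
  with LP_dist_nonneg[of m \<mu> \<mu>] show ?thesis by linarith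
qed

lemma Metric_space_fin_measures: "Metric_space (fin_measures n (mspace m)) (LP_dist m)"
  unfolding Metric_space_def
proof (intro conjI allI impI)
  fix \<mu> \<nu> :: "'a pmf"
  show "0 \<le> LP_dist m \<mu> \<nu>" by (rule LP_dist_nonneg)
next
  fix \<mu> \<nu> :: "'a pmf"
  show "LP_dist m \<mu> \<nu> = LP_dist m \<nu> \<mu>"
    by (simp add: LP_dist_def LP_good_commute[of m \<mu> \<nu>])
next
  fix \<mu> \<nu> assume *: "\<mu> \<in> fin_measures n (mspace m)" "\<nu> \<in> fin_measures n (mspace m)"
  show "LP_dist m \<mu> \<nu> = 0 \<longleftrightarrow> \<mu> = \<nu>"
  proof
    assume 0: "LP_dist m \<mu> \<nu> = 0"
    then have 00: "LP_dist m \<nu> \<mu> = 0"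
      by (simp add: LP_dist_def LP_good_commute[of m \<mu> \<nu>])
    show "\<mu> = \<nu>"
    proof (rule pmf_eqI)
      fix x
      show "pmf \<mu> x = pmf \<nu> x"
      proof (cases "x \<in> mspace m")
        case True
        then show ?thesis
          using LP_zero_imp_le[OF _ _ True 0] LP_zero_imp_le[OF _ _ True 00] *
          by (auto simp: fin_measures_def intro!: antisym)
      next
        case False
        with * have "x \<notin> set_pmf \<mu>" "x \<notin> set_pmf \<nu>" by (auto simp: fin_measures_def)
        then show ?thesis by (simp add: set_pmf_iff)
      qed
    qed
  qed (simp add: LP_refl)
next
  fix \<mu> \<nu> \<rho> :: "'a pmf"
  show "LP_dist m \<mu> \<rho> \<le> LP_dist m \<mu> \<nu> + LP_dist m \<nu> \<rho>"
  proof (rule field_le_epsilon)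
    fix e :: real assume "e > 0"
    then have "LP_good m \<mu> \<nu> (LP_dist m \<mu> \<nu> + e/2)" "LP_good m \<nu> \<rho> (LP_dist m \<nu> \<rho> + e/2)"
      by (auto intro: LP_dist_less)
    from LP_dist_le[OF LP_good_trans[OF this]]
    show "LP_dist m \<mu> \<rho> \<le> LP_dist m \<mu> \<nu> + LP_dist m \<nu> \<rho> + e" by simp
  qed
qed

lemma mspace_fin_measures_metric [simp]:
    "mspace (fin_measures_metric n m) = fin_measures n (mspace m)"
  and mdist_fin_measures_metric [simp]: "mdist (fin_measures_metric n m) = LP_dist m"
  by (simp_all add: fin_measures_metric_def Metric_space_fin_measures
      Metric_space.mspace_metric Metric_space.mdist_metric)

lemma topspace_path_topology [simp]: "topspace (path_topology Z) = paths Z"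
proof
  show "topspace (path_topology Z) \<subseteq> paths Z"
    by (auto simp: path_topology_def)
  have "paths Z = {g \<in> paths Z. g ` {} \<subseteq> topspace Z}" "compact ({}::real set)" by auto
  then have "openin (path_topology Z) (paths Z)"
    unfolding path_topology_def by (intro topology_generated_by_Basis) blast
  then show "paths Z \<subseteq> topspace (path_topology Z)"
    by (rule openin_subset)
qed

end

theory Submission
  imports Defs
begin

text \<open>
  Suppose \<open>iTC X \<le> 1\<close>. A planner assigns to \<open>p = (x, y)\<close> a path \<open>t \<mapsto> s p t\<close> of measures with at most two
  atoms, which runs from \<open>\<delta>\<^sub>x\<close> to \<open>\<delta>\<^sub>y\<close> and depends continuously on \<open>p\<close>. The claim is that
  \<open>X \<times> X\<close> is the union of two open sets \<open>U\<close> and \<open>V\<close> such that \<open>\<beta>\<^sub>1\<close> restricts to zero on \<open>U\<close> and \<open>\<beta>\<^sub>2\<close>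
  to zero on \<open>V\<close>; then \<open>\<beta>\<^sub>1 \<smile> \<beta>\<^sub>2 = 0\<close> (\<open>AS_cup_open_cover\<close>), a contradiction.

  Since \<open>X\<close> is an ANR and sits in the space of measures as the closed set of Dirac measures, some
  open neighbourhood \<open>W\<close> of the Dirac measures retracts to \<open>X\<close> by a map \<open>r\<close>
  (\<open>ANR_space_neighbourhood_retraction\<close>). Let \<open>U\<close> consist of the \<open>p\<close> whose path stays in \<open>W\<close>, and \<open>V\<close>
  of the \<open>p\<close> whose path does not consist of Dirac measures only. Both are open, and they cover: a path
  of Dirac measures stays in \<open>W\<close>.

  On \<open>U\<close> the planner gives honest paths \<open>r (s p t)\<close> in \<open>X\<close>, so \<open>(x, y) \<mapsto> (x, r (s p t))\<close> is a homotopy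
  from \<open>(x, x)\<close> to the inclusion. The map \<open>(x, y) \<mapsto> (x, x)\<close> factors through the diagonal of \<open>X\<close>,
  so a zero-divisor vanishes on \<open>U\<close>.

  On \<open>V\<close> write \<open>{u, v}\<close> for the support of \<open>s p t\<close>, where \<open>u = v\<close> is allowed. Then \<open>[(x, u), (x, v)]\<close> is a
  homotopy in \<open>SP\<^sup>2(X \<times> X)\<close> from \<open>[(x, x), (x, x)]\<close> to \<open>[(x, y), (x, y)]\<close>, so a zero-divisor that
  comes from \<open>SP\<^sup>2(X \<times> X)\<close> vanishes on \<open>V\<close>. The delicate point is the continuity of this homotopy,
  because the support of a measure is discontinuous where the weight of an atom tends to zero. This is
  where resolvability enters: a resolvable path moves its atoms along two paths of fixed weights, so
  once the path splits at a single time, the weights are bounded away from zero at all times, locally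
  uniformly in \<open>p\<close> (\<open>resolvable_path_atoms\<close>, \<open>not_Dirac_near\<close>, \<open>planner_pairs_continuous\<close>).

  The remaining ingredient is homotopy invariance of Alexander--Spanier cohomology on the metrizable
  spaces \<open>U\<close> and \<open>V\<close> (\<open>AS_pullback_homotopic\<close>). Over a noncompact space no uniform subdivision of \<open>[0, 1]\<close>
  serves all points, so the homotopy is traversed in steps whose size \<open>\<epsilon> y\<close> is a continuous function
  of the point (\<open>exists_lebesgue_function\<close>). Consecutive steps are so close that the prism operators give
  cochain homotopies modulo locally zero cochains, and their sum is locally finite.
\<close>

section \<open>The prism operator\<close>

text \<open>
  The classical prism operator on the ordered simplices \<open>f y\<^sub>0, ..., f y\<^sub>j, g y\<^sub>j, ..., g y\<^sub>q\<close>.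
\<close>

definition prism :: "nat \<Rightarrow> 'a topology \<Rightarrow> ('a \<Rightarrow> 'b) \<Rightarrow> ('a \<Rightarrow> 'b) \<Rightarrow> ('b list \<Rightarrow> 'r::ring_1) \<Rightarrow> 'a list \<Rightarrow> 'r" where
  "prism q Y f g \<phi> = (\<lambda>ys. if ys \<in> tuples q Y
     then \<Sum>j\<le>q. (-1) ^ j * \<phi> (map f (take (Suc j) ys) @ map g (drop j ys)) else 0)"

lemma omit_append:
  "omit i (xs @ ys) = (if i < length xs then omit i xs @ ys else xs @ omit (i - length xs) ys)"
  by (auto simp: omit_def Suc_diff_le)

lemma omit_take_drop:
  assumes "i < length xs"
  shows "i < j \<Longrightarrow> take j (omit i xs) = omit i (take (Suc j) xs)"
    and "i \<le> j \<Longrightarrow> drop j (omit i xs) = drop (Suc j) xs"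
    and "j \<le> i \<Longrightarrow> take j (omit i xs) = take j xs"
    and "j \<le> i \<Longrightarrow> drop j (omit i xs) = omit (i - j) (drop j xs)"
  using assms by (auto simp: omit_def take_drop min_def Suc_diff_le)

lemma prism_tuple:
  assumes "continuous_map Y Z f" "continuous_map Y Z g" "ys \<in> tuples q Y" "j \<le> q"
  shows "map f (take (Suc j) ys) @ map g (drop j ys) \<in> tuples (Suc q) Z"
proof -
  have "f y \<in> topspace Z" "g y \<in> topspace Z" if "y \<in> set ys" for y
  proof -
    have "y \<in> topspace Y" using assms(3) that by (auto simp: tuples_def)
    then show "f y \<in> topspace Z" "g y \<in> topspace Z"
      using assms(1,2) by (auto simp: continuous_map_def)
  qed
  then show ?thesis
    using assms(3,4) set_take_subset[of "Suc j" ys] set_drop_subset[of j ys]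
    by (auto simp: tuples_def)
qed

text \<open>
  In the double sum for \<open>prism (\<delta> \<phi>)\<close> one entry of \<open>f y\<^sub>0, ..., f y\<^sub>j, g y\<^sub>j, ..., g y\<^sub>q\<close> is omitted.
  Omitting an entry other than the two copies of \<open>y\<^sub>j\<close> gives the terms of \<open>\<delta> (prism \<phi>)\<close> with the opposite
  sign. Omitting \<open>f y\<^sub>j\<close> or \<open>g y\<^sub>j\<close> gives a telescoping sum, of which only the two ends survive.
\<close>

lemma prism_homotopy:
  fixes \<phi> :: "'b list \<Rightarrow> 'r::ring_1"
  assumes f: "continuous_map Y Z f" and g: "continuous_map Y Z g"
    and ys: "ys \<in> tuples (Suc q) Y"
  shows "AS_delta q Y (prism q Y f g \<phi>) ys + prism (Suc q) Y f g (AS_delta (Suc q) Z \<phi>) ys =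
    \<phi> (map g ys) - \<phi> (map f ys)"
proof -
  have len: "length ys = Suc (Suc q)" using ys by (simp add: tuples_def)
  define L where "L xs j = map f (take (Suc j) xs) @ map g (drop j xs)" for xs j
  define M where "M j = map f (take j ys) @ map g (drop j ys)" for j
  let ?P = "{..Suc q} \<times> {..Suc (Suc q)}"
  define F where "F = (\<lambda>(j, i). (-1) ^ (j + i) * \<phi> (omit i (L ys j)))"
  define G where "G = (\<lambda>(j, i). (-1) ^ (j + i) * \<phi> (L (omit i ys) j))"
  \<comment> \<open>The position \<open>i\<close> of the omitted entry lies before, at the first, at the second, or after the
    two copies of \<open>y\<^sub>j\<close>.\<close>
  let ?A = "{(j, i) \<in> ?P. i < j}" and ?B = "{(j, i) \<in> ?P. i = j}"
    and ?C = "{(j, i) \<in> ?P. i = Suc j}" and ?D = "{(j, i) \<in> ?P. Suc j < i}"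
  let ?Q = "{..q} \<times> {..Suc q}"
  let ?A' = "{(j, i) \<in> ?Q. i \<le> j}" and ?D' = "{(j, i) \<in> ?Q. j < i}"
  have omit_lt: "omit i (L ys j) = L (omit i ys) (j - 1)" if "i < j" "j \<le> Suc q" for i j
    using that by (auto simp: L_def omit_append map_omit[symmetric] omit_take_drop len)
  have omit_gt: "omit i (L ys j) = L (omit (i - 1) ys) j" if "Suc j < i" "i \<le> Suc (Suc q)" for i j
  proof -
    have "i - Suc j = (i - 1) - j" by simp
    then show ?thesis
      using that by (auto simp: L_def omit_append map_omit[symmetric] omit_take_drop len)
  qed
  have omit_eq: "omit j (L ys j) = M j" if "j \<le> Suc q" for j
    using that by (auto simp: L_def M_def omit_append len) (auto simp: omit_def take_map[symmetric])
  have omit_Suc: "omit (Suc j) (L ys j) = M (Suc j)" if "j \<le> Suc q" for j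
    using that by (auto simp: L_def M_def omit_append len)
      (auto simp: omit_def drop_map[symmetric])
  have fin: "finite {(j, i) \<in> ?P. R j i}" for R by (rule finite_subset[of _ ?P]) auto
  have fin': "finite {(j, i) \<in> ?Q. R j i}" for R by (rule finite_subset[of _ ?Q]) auto
  have "prism (Suc q) Y f g (AS_delta (Suc q) Z \<phi>) ys = sum F ?P"
    using ys prism_tuple[OF f g ys]
    by (simp add: prism_def AS_delta_def F_def L_def sum.cartesian_product[symmetric] sum_distrib_left
        power_add mult.assoc del: sum.atMost_Suc)
  also have "?P = ?A \<union> ?B \<union> ?C \<union> ?D" by auto
  also have "sum F \<dots> = sum F ?A + sum F ?B + sum F ?C + sum F ?D"
    by (subst sum.union_disjoint; (intro finite_UnI fin)?; force?)+
  also have "sum F ?A = sum (\<lambda>p. - G p) ?A'"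
    by (rule sum.reindex_bij_witness[where i = "\<lambda>(j, i). (Suc j, i)" and j = "\<lambda>(j, i). (j - 1, i)"])
      (auto simp: F_def G_def omit_lt power_add dest!: less_imp_Suc_add)
  also have "sum F ?D = sum (\<lambda>p. - G p) ?D'"
    by (rule sum.reindex_bij_witness[where i = "\<lambda>(j, i). (j, Suc i)" and j = "\<lambda>(j, i). (j, i - 1)"])
      (auto simp: F_def G_def omit_gt power_add dest!: less_imp_Suc_add)
  also have "sum F ?B = (\<Sum>j\<le>Suc q. \<phi> (M j))"
    by (rule sum.reindex_bij_witness[where i = "\<lambda>j. (j, j)" and j = fst])
      (auto simp: F_def omit_eq)
  also have "sum F ?C = (\<Sum>j\<le>Suc q. - \<phi> (M (Suc j)))"
    by (rule sum.reindex_bij_witness[where i = "\<lambda>j. (j, Suc j)" and j = fst])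
      (auto simp: F_def omit_Suc)
  finally have 1: "prism (Suc q) Y f g (AS_delta (Suc q) Z \<phi>) ys =
      - (sum G ?A' + sum G ?D') + (\<Sum>j\<le>Suc q. \<phi> (M j) - \<phi> (M (Suc j)))"
    by (simp add: sum_negf sum_subtractf algebra_simps del: sum.atMost_Suc)
  have "(\<Sum>j\<le>Suc q. \<phi> (M j) - \<phi> (M (Suc j))) = \<phi> (M 0) - \<phi> (M (Suc (Suc q)))"
    by (rule sum_telescope)
  also have "\<dots> = \<phi> (map g ys) - \<phi> (map f ys)"
    by (simp add: M_def len)
  finally have 2: "(\<Sum>j\<le>Suc q. \<phi> (M j) - \<phi> (M (Suc j))) = \<phi> (map g ys) - \<phi> (map f ys)" .
  have "AS_delta q Y (prism q Y f g \<phi>) ys =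
      (\<Sum>i\<le>Suc q. \<Sum>j\<le>q. (-1) ^ i * ((-1) ^ j * \<phi> (L (omit i ys) j)))"
    using ys omit_tuples[OF ys]
    by (simp add: AS_delta_def prism_def L_def sum_distrib_left del: sum.atMost_Suc)
  also have "\<dots> = sum G ?Q"
    by (subst sum.swap) (simp add: G_def sum.cartesian_product[symmetric] power_add mult.assoc
        power_commuting_commutes add.commute del: sum.atMost_Suc flip: power_add)
  also have "?Q = ?A' \<union> ?D'" by auto
  also have "sum G \<dots> = sum G ?A' + sum G ?D'"
    by (rule sum.union_disjoint; (rule fin')?; force?)
  finally show ?thesis using 1 2 by simp
qed

lemma prism_cong:
  assumes "\<And>y. y \<in> set ys \<Longrightarrow> f y = f' y" "\<And>y. y \<in> set ys \<Longrightarrow> g y = g' y"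
  shows "prism q Y f g \<phi> ys = prism q Y f' g' \<phi> ys"
proof -
  have "map f (take (Suc j) ys) = map f' (take (Suc j) ys)" "map g (drop j ys) = map g' (drop j ys)" for j
    using assms by (auto dest: in_set_takeD in_set_dropD)
  then show ?thesis unfolding prism_def by presburger
qed

lemma prism_vanish:
  assumes f: "continuous_map Y Z f" and g: "continuous_map Y Z g"
    and W: "f ` set ys \<subseteq> W" "g ` set ys \<subseteq> W"
    and \<theta>: "\<And>zs. zs \<in> tuples (Suc q) Z \<Longrightarrow> set zs \<subseteq> W \<Longrightarrow> \<theta> zs = 0"
  shows "prism q Y f g \<theta> ys = 0"
proof (cases "ys \<in> tuples q Y")
  case True
  have "\<theta> (map f (take (Suc j) ys) @ map g (drop j ys)) = 0" if "j \<le> q" for j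
  proof (intro \<theta> prism_tuple[OF f g True that])
    have "f ` set (take (Suc j) ys) \<subseteq> W" "g ` set (drop j ys) \<subseteq> W"
      using W by (meson image_mono set_take_subset set_drop_subset subset_trans)+
    then show "set (map f (take (Suc j) ys) @ map g (drop j ys)) \<subseteq> W" by simp
  qed
  then show ?thesis by (simp add: prism_def)
qed (simp add: prism_def)

section \<open>Homotopy invariance of Alexander--Spanier cohomology\<close>

text \<open>
  Adding up the prism operators between consecutive \<open>f k\<close> should give a cochain homotopy from \<open>f 0\<close> to
  \<open>g\<close>. But the prism operator from \<open>g\<close> to \<open>g\<close> need not vanish, so that the sum over the infinitely many
  stationary \<open>k\<close> makes no sense. As this operator is a cochain homotopy from a map to itself, it can
  be subtracted from every summand without changing the boundary formula, and then all stationary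
  summands vanish.
\<close>

lemma AS_pullback_sequence:
  fixes \<phi> :: "'b list \<Rightarrow> 'r::ring_1"
  assumes f: "\<And>k. continuous_map Y Z (f k)" and g: "continuous_map Y Z g"
    and eventually_g: "\<And>y. y \<in> topspace Y \<Longrightarrow>
      \<exists>U K. openin Y U \<and> y \<in> U \<and> (\<forall>k\<ge>K. \<forall>x\<in>U. f k x = g x)"
    and close: "\<And>y k. y \<in> topspace Y \<Longrightarrow> \<exists>W. openin Z W \<and> f k y \<in> W \<and> f (Suc k) y \<in> W \<and>
      (\<forall>zs\<in>tuples (Suc (Suc q)) Z. set zs \<subseteq> W \<longrightarrow> AS_delta (Suc q) Z \<phi> zs = 0)"
  shows "(\<lambda>ys. AS_pullback (Suc q) Y g \<phi> ys - AS_pullback (Suc q) Y (f 0) \<phi> ys)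
    \<in> AS_coboundaries (Suc q) Y"
proof -
  have "\<exists>K. \<forall>k\<ge>K. f k y = g y" if "y \<in> topspace Y" for y
    using eventually_g[OF that] by blast
  then obtain N where N: "\<And>y k. y \<in> topspace Y \<Longrightarrow> N y \<le> k \<Longrightarrow> f k y = g y"
    by metis
  define R where "R p k \<theta> ys = prism p Y (f k) (f (Suc k)) \<theta> ys - prism p Y g g \<theta> ys"
    for p k and \<theta> :: "'b list \<Rightarrow> 'r" and ys
  have R_zero: "R p k \<theta> ys = 0" if "\<And>y. y \<in> set ys \<Longrightarrow> f k y = g y \<and> f (Suc k) y = g y" for p k \<theta> ys
    using prism_cong[of ys "f k" g "f (Suc k)" g p Y \<theta>] that by (simp add: R_def)
  \<comment> \<open>Any bound beyond which all entries of \<open>ys\<close> are stationary gives the same sum.\<close>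
  define \<psi> where "\<psi> ys = (\<Sum>k<sum_list (map N ys). R q k \<phi> ys)" for ys
  have \<psi>: "\<psi> ys = (\<Sum>k<K. R q k \<phi> ys)"
    if "ys \<in> tuples q Y" and K: "\<And>y k. y \<in> set ys \<Longrightarrow> K \<le> k \<Longrightarrow> f k y = g y" for ys K
  proof -
    let ?B = "sum_list (map N ys)"
    have B: "f k y = g y" if "y \<in> set ys" "?B \<le> k" for y k
    proof -
      have "N y \<le> ?B" using that(1) by (simp add: member_le_sum_list)
      moreover have "y \<in> topspace Y" using \<open>ys \<in> _\<close> that(1) by (auto simp: tuples_def)
      ultimately show ?thesis using N that(2) by simp
    qed
    have "(\<Sum>k<?B. R q k \<phi> ys) = (\<Sum>k<max ?B K. R q k \<phi> ys)"
      by (rule sum.mono_neutral_left) (auto intro!: R_zero B)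
    also have "\<dots> = (\<Sum>k<K. R q k \<phi> ys)"
      by (rule sum.mono_neutral_right) (auto intro!: R_zero K)
    finally show ?thesis by (simp add: \<psi>_def)
  qed
  have \<psi>_cochain: "\<psi> \<in> AS_cochains q Y"
    by (simp add: AS_cochains_def \<psi>_def R_def prism_def)
  have R_homotopy: "AS_delta q Y (R q k \<phi>) ys =
      \<phi> (map (f (Suc k)) ys) - \<phi> (map (f k) ys) - R (Suc q) k (AS_delta (Suc q) Z \<phi>) ys"
    if "ys \<in> tuples (Suc q) Y" for k ys
  proof -
    have "AS_delta q Y (R q k \<phi>) ys =
        AS_delta q Y (prism q Y (f k) (f (Suc k)) \<phi>) ys - AS_delta q Y (prism q Y g g \<phi>) ys"
      using that by (simp add: AS_delta_def R_def right_diff_distrib sum_subtractf del: sum.atMost_Suc)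
    also have "\<dots> = \<phi> (map (f (Suc k)) ys) - \<phi> (map (f k) ys)
        - prism (Suc q) Y (f k) (f (Suc k)) (AS_delta (Suc q) Z \<phi>) ys
        - (0 - prism (Suc q) Y g g (AS_delta (Suc q) Z \<phi>) ys)"
      using eq_diff_eq[THEN iffD2, OF prism_homotopy[OF f f that, of k "Suc k" \<phi>]]
        eq_diff_eq[THEN iffD2, OF prism_homotopy[OF g g that, of \<phi>]] by simp
    finally show ?thesis by (simp add: R_def)
  qed
  let ?\<delta> = "AS_delta (Suc q) Z \<phi>"
  let ?\<zeta> = "\<lambda>ys. AS_pullback (Suc q) Y g \<phi> ys - AS_pullback (Suc q) Y (f 0) \<phi> ys - AS_delta q Y \<psi> ys"
  have "?\<zeta> \<in> AS_locally_zero (Suc q) Y"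
    unfolding AS_locally_zero_iff
  proof (intro conjI ballI)
    show "?\<zeta> \<in> AS_cochains (Suc q) Y"
      by (simp add: AS_cochains_def AS_pullback_def AS_delta_def)
    fix y assume y: "y \<in> topspace Y"
    obtain U K where U: "openin Y U" "y \<in> U" "\<And>k x. K \<le> k \<Longrightarrow> x \<in> U \<Longrightarrow> f k x = g x"
      using eventually_g[OF y] by blast
    obtain W where W: "\<And>k. openin Z (W k)" "\<And>k. f k y \<in> W k" "\<And>k. f (Suc k) y \<in> W k"
      "\<And>k zs. zs \<in> tuples (Suc (Suc q)) Z \<Longrightarrow> set zs \<subseteq> W k \<Longrightarrow> ?\<delta> zs = 0"
      using close[OF y] by metis
    define A where "A k = {x \<in> topspace Y. f k x \<in> W k} \<inter> {x \<in> topspace Y. f (Suc k) x \<in> W k}" for k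
    have A: "openin Y (A k)" "y \<in> A k" for k
      using W y openin_continuous_map_preimage[OF f W(1)] by (auto simp: A_def)
    let ?V = "U \<inter> (\<Inter>k\<le>K. A k)"
    have "?\<zeta> ys = 0" if ys: "ys \<in> tuples (Suc q) Y" "set ys \<subseteq> ?V" for ys
    proof -
      have small: "f k ` set ys \<subseteq> W k" "f (Suc k) ` set ys \<subseteq> W k" if "k \<le> K" for k
        using ys(2) that by (auto simp: A_def)
      have small_g: "g ` set ys \<subseteq> W K"
      proof
        fix z assume "z \<in> g ` set ys"
        then obtain x where x: "x \<in> set ys" "z = g x" by blast
        then have "x \<in> U" using ys(2) by blast
        then have "z = f K x" using U(3)[of K x] x(2) by simp
        then show "z \<in> W K" using small(1)[of K] x(1) by blast
      qed
      have R\<delta>: "R (Suc q) k ?\<delta> ys = 0" if "k \<le> K" for k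
        using prism_vanish[OF f f small(1)[OF that] small(2)[OF that], of "Suc q" ?\<delta>] W(4)
          prism_vanish[OF g g small_g small_g, of "Suc q" ?\<delta>] by (simp add: R_def)
      have sub: "\<psi> (omit i ys) = (\<Sum>k<K. R q k \<phi> (omit i ys))" if "i \<le> Suc q" for i
        using omit_tuples[OF ys(1) that] set_omit[of i ys] ys(2) U(3) by (intro \<psi>) auto
      have "AS_delta q Y \<psi> ys = (\<Sum>i\<le>Suc q. \<Sum>k<K. (-1) ^ i * R q k \<phi> (omit i ys))"
        using ys(1) sub by (simp add: AS_delta_def sum_distrib_left del: sum.atMost_Suc)
      also have "\<dots> = (\<Sum>k<K. AS_delta q Y (R q k \<phi>) ys)"
        using ys(1) by (subst sum.swap) (simp add: AS_delta_def del: sum.atMost_Suc)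
      also have "\<dots> = (\<Sum>k<K. \<phi> (map (f (Suc k)) ys) - \<phi> (map (f k) ys))"
        using R\<delta> by (simp add: R_homotopy[OF ys(1)])
      also have "\<dots> = \<phi> (map (f K) ys) - \<phi> (map (f 0) ys)"
        by (rule sum_lessThan_telescope)
      also have "map (f K) ys = map g ys"
        using U(3) ys(2) by auto
      finally show ?thesis using ys(1) by (simp add: AS_pullback_def)
    qed
    moreover have "openin Y ?V"
      using U(1) A(1) by (intro openin_Int openin_INT) auto
    ultimately show "\<exists>V. openin Y V \<and> y \<in> V \<and>
        (\<forall>ys\<in>tuples (Suc q) Y. set ys \<subseteq> V \<longrightarrow> ?\<zeta> ys = 0)"
      using U(2) A(2) by (intro exI[of _ ?V]) auto
  qed
  then show ?thesis
    unfolding AS_coboundaries_Suc using \<psi>_cochain by (intro exI[of _ \<psi>] exI[of _ ?\<zeta>]) auto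
qed

text \<open>
  By compactness of \<open>[0, 1]\<close> every point \<open>y\<close> has a ball of some radius \<open>r\<close> such that \<open>r\<close> is a Lebesgue
  number of \<open>[0, 1] \<times> {z}\<close> for every \<open>z\<close> in this ball. Asking for one number in both roles makes the
  supremum of the admissible \<open>r\<close> a 1-Lipschitz function of \<open>y\<close>: passing from \<open>y\<close> to a point at
  distance \<open>d\<close> costs at most \<open>d\<close>. Half of the supremum is taken because the supremum itself need not be
  attained.
\<close>

lemma exists_lebesgue_function:
  assumes "metrizable_space Y"
    and cover: "{0..1} \<times> topspace Y \<subseteq> \<Union>\<O>"
    and opn: "\<And>G. G \<in> \<O> \<Longrightarrow> openin (prod_topology (top_of_set {0..1::real}) Y) G"
  obtains \<epsilon> where "continuous_map Y euclideanreal \<epsilon>" "\<And>y. y \<in> topspace Y \<Longrightarrow> 0 < \<epsilon> y"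
    "\<And>y s t. \<lbrakk>y \<in> topspace Y; s \<in> {0..1}; t \<in> {0..1}; \<bar>s - t\<bar> \<le> \<epsilon> y\<rbrakk> \<Longrightarrow>
       \<exists>G\<in>\<O>. (s, y) \<in> G \<and> (t, y) \<in> G"
proof -
  obtain M d where "Metric_space M d" and Y: "Y = Metric_space.mtopology M d"
    using assms(1) unfolding metrizable_space_def by blast
  interpret Metric_space M d by fact
  define good where "good y r \<longleftrightarrow> (\<forall>s\<in>{0..1}. \<forall>t\<in>{0..1}. \<bar>s - t\<bar> \<le> r \<longrightarrow>
      (\<exists>G\<in>\<O>. (s, y) \<in> G \<and> (t, y) \<in> G))" for y and r :: real
  have good_mono: "good y r" if "good y r'" "r \<le> r'" for y r r'
    using that by (auto simp: good_def)
  have good_ex: "\<exists>r>0. r \<le> 1 \<and> (\<forall>z\<in>M. d y z < r \<longrightarrow> good z r)" if y: "y \<in> M" for y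
  proof -
    have "\<exists>r>0. \<exists>G\<in>\<O>. \<forall>s\<in>{0..1}. \<forall>z\<in>M. \<bar>s - t\<bar> < 2 * r \<longrightarrow> d y z < r \<longrightarrow> (s, z) \<in> G"
      if t: "t \<in> {0..1}" for t :: real
    proof -
      have "(t, y) \<in> {0..1} \<times> topspace Y" using y t by (simp add: Y)
      then obtain G where G: "G \<in> \<O>" "(t, y) \<in> G" using cover by blast
      then obtain A B where AB: "openin (top_of_set {0..1}) A" "openin Y B" "t \<in> A" "y \<in> B" "A \<times> B \<subseteq> G"
        using opn[OF G(1)] unfolding openin_prod_topology_alt by meson
      obtain T where T: "open T" "A = {0..1} \<inter> T" using AB(1) by (auto simp: openin_open)
      obtain e where e: "e > 0" "\<And>s. \<bar>s - t\<bar> < e \<Longrightarrow> s \<in> T"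
        using T AB(3) by (auto simp: open_dist dist_real_def)
      obtain e' where e': "e' > 0" "mball y e' \<subseteq> B" using AB(2,4) unfolding Y openin_mtopology by blast
      show ?thesis
      proof (intro exI[of _ "min (e / 2) e'"] conjI bexI[OF _ G(1)] ballI impI)
        show "0 < min (e / 2) e'" using e e' by simp
        fix s z assume "s \<in> {0..1}" "z \<in> M" "\<bar>s - t\<bar> < 2 * min (e / 2) e'" "d y z < min (e / 2) e'"
        then have "s \<in> A" "z \<in> B" using e(2)[of s] e' T(2) y by (auto simp: mball_def)
        then show "(s, z) \<in> G" using AB(5) by blast
      qed
    qed
    then obtain r where r: "\<And>t. t \<in> {0..1} \<Longrightarrow> 0 < r t \<and> (\<exists>G\<in>\<O>. \<forall>s\<in>{0..1}. \<forall>z\<in>M.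
        \<bar>s - t\<bar> < 2 * r t \<longrightarrow> d y z < r t \<longrightarrow> (s, z) \<in> G)" by metis
    have "{0..1} \<subseteq> (\<Union>t\<in>{0..1}. ball t (r t))" using r by fastforce
    then obtain T where T: "T \<subseteq> {0..1}" "finite T" "{0..1} \<subseteq> (\<Union>t\<in>T. ball t (r t))"
      using compactE_image[of "{0..1::real}" "{0..1}" "\<lambda>t. ball t (r t)"] by auto
    define \<rho> where "\<rho> = Min (insert 1 (r ` T))"
    have \<rho>: "\<rho> \<le> 1" "\<And>t. t \<in> T \<Longrightarrow> \<rho> \<le> r t" using T(2) by (auto simp: \<rho>_def)
    have "0 < \<rho>" using T(1,2) r by (auto simp: \<rho>_def)
    moreover have "good z \<rho>" if z: "z \<in> M" "d y z < \<rho>" for z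
      unfolding good_def
    proof (intro ballI impI)
      fix s u :: real assume su: "s \<in> {0..1}" "u \<in> {0..1}" "\<bar>s - u\<bar> \<le> \<rho>"
      obtain t where "t \<in> T" "s \<in> ball t (r t)" using T(3) su(1) by blast
      then have t: "t \<in> T" "\<bar>s - t\<bar> < r t" by (auto simp: dist_real_def)
      have t01: "t \<in> {0..1}" using t T by blast
      have *: "\<bar>s - t\<bar> < 2 * r t" "\<bar>u - t\<bar> < 2 * r t" "d y z < r t"
        using t su(3) \<rho>(2)[OF t(1)] z(2) by linarith+
      obtain G where "G \<in> \<O>" "\<forall>s\<in>{0..1}. \<forall>z\<in>M. \<bar>s - t\<bar> < 2 * r t \<longrightarrow> d y z < r t \<longrightarrow> (s, z) \<in> G"
        using r[OF t01] by blast
      then show "\<exists>G\<in>\<O>. (s, z) \<in> G \<and> (u, z) \<in> G" using * su(1,2) z(1) by blast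
    qed
    ultimately show ?thesis using \<rho>(1) by blast
  qed
  define A where "A y = {r. 0 < r \<and> r \<le> 1 \<and> (\<forall>z\<in>M. d y z < r \<longrightarrow> good z r)}" for y
  have A_bdd: "bdd_above (A y)" for y by (rule bdd_aboveI[of _ 1]) (auto simp: A_def)
  have A_ne: "A y \<noteq> {}" if "y \<in> M" for y using good_ex[OF that] by (auto simp: A_def)
  define \<epsilon> where "\<epsilon> y = Sup (A y) / 2" for y
  have pos: "0 < \<epsilon> y" if y: "y \<in> M" for y
  proof -
    obtain r where r: "r \<in> A y" using A_ne[OF y] by blast
    then have "r \<le> Sup (A y)" by (rule cSup_upper[OF _ A_bdd])
    with r show ?thesis by (simp add: \<epsilon>_def A_def)
  qed
  have "good y (\<epsilon> y)" if y: "y \<in> M" for y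
  proof -
    have "\<epsilon> y < Sup (A y)" using pos[OF y] by (simp add: \<epsilon>_def)
    then obtain r where "r \<in> A y" "\<epsilon> y < r" using less_cSup_iff[OF A_ne[OF y] A_bdd] by blast
    then show ?thesis using y good_mono[of y r "\<epsilon> y"] by (simp add: A_def)
  qed
  then have good: "\<exists>G\<in>\<O>. (s, y) \<in> G \<and> (t, y) \<in> G"
    if "y \<in> topspace Y" "s \<in> {0..1}" "t \<in> {0..1}" "\<bar>s - t\<bar> \<le> \<epsilon> y" for y s t
    using that by (simp add: good_def Y)
  have lip: "Sup (A y) \<le> Sup (A z) + d y z" if "y \<in> M" "z \<in> M" for y z
  proof (rule cSup_least[OF A_ne[OF that(1)]])
    fix r assume r: "r \<in> A y"
    show "r \<le> Sup (A z) + d y z"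
    proof (cases "r - d y z > 0")
      case True
      have "good w (r - d y z)" if "w \<in> M" "d z w < r - d y z" for w
      proof -
        have "d y w < r" using triangle[OF \<open>y \<in> M\<close> \<open>z \<in> M\<close> \<open>w \<in> M\<close>] that by linarith
        then have "good w r" using r \<open>w \<in> M\<close> by (simp add: A_def)
        then show ?thesis by (rule good_mono) simp
      qed
      moreover have "r - d y z \<le> 1"
      proof -
        have "r \<le> 1" using r by (simp add: A_def)
        with nonneg[of y z] show ?thesis by linarith
      qed
      ultimately have "r - d y z \<in> A z" using True by (simp add: A_def)
      then show ?thesis using cSup_upper[OF _ A_bdd] by fastforce
    next
      case False
      then show ?thesis using pos[OF that(2)] by (simp add: \<epsilon>_def)
    qed
  qed
  have "continuous_map Y euclideanreal \<epsilon>"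
    unfolding Y continuous_map_from_metric
  proof (intro conjI ballI allI impI)
    fix a U assume a: "a \<in> M" and U: "openin euclideanreal U \<and> \<epsilon> a \<in> U"
    then obtain e where e: "e > 0" "\<And>x. \<bar>x - \<epsilon> a\<bar> < e \<Longrightarrow> x \<in> U"
      by (auto simp: open_dist dist_real_def)
    have "\<epsilon> x \<in> U" if "x \<in> M" "d a x < e" for x
      using lip[OF a that(1)] lip[OF that(1) a] that(2) commute[of a x] e(1)
      by (intro e(2)) (simp add: \<epsilon>_def abs_if field_simps)
    with e(1) show "\<exists>r>0. \<forall>x. x \<in> M \<and> d a x < r \<longrightarrow> \<epsilon> x \<in> U" by blast
  qed simp
  then show thesis using that pos good by (simp add: Y)
qed

text \<open>
  Time is traversed at the point \<open>y\<close> in steps of length \<open>\<epsilon> y\<close>, where \<open>\<epsilon>\<close> is a Lebesgue function for the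
  cover of \<open>[0, 1] \<times> Y\<close> by preimages of open sets on which \<open>\<delta> \<phi>\<close> vanishes. Since \<open>\<epsilon>\<close> is locally
  bounded below, the resulting sequence of maps is locally stationary at the end of the homotopy.
\<close>

lemma AS_pullback_homotopic:
  fixes \<phi> :: "'b list \<Rightarrow> 'r::ring_1"
  assumes Y: "metrizable_space Y" and "homotopic_with (\<lambda>_. True) Y Z a b"
    and \<phi>: "\<phi> \<in> AS_cocycles (Suc q) Z"
  shows "(\<lambda>ys. AS_pullback (Suc q) Y b \<phi> ys - AS_pullback (Suc q) Y a \<phi> ys)
    \<in> AS_coboundaries (Suc q) Y"
proof -
  let ?I = "top_of_set {0..1::real}"
  obtain h where h: "continuous_map (prod_topology ?I Y) Z h" "\<And>y. h (0, y) = a y" "\<And>y. h (1, y) = b y"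
    using assms(2) unfolding homotopic_with_def by blast
  define vanish where "vanish W \<longleftrightarrow>
      (\<forall>zs\<in>tuples (Suc (Suc q)) Z. set zs \<subseteq> W \<longrightarrow> AS_delta (Suc q) Z \<phi> zs = 0)" for W
  have van: "\<exists>W. openin Z W \<and> z \<in> W \<and> vanish W" if "z \<in> topspace Z" for z
    using \<phi> that unfolding AS_cocycles_def AS_locally_zero_iff vanish_def by blast
  let ?pre = "\<lambda>W. {p \<in> topspace (prod_topology ?I Y). h p \<in> W}"
  define \<O> where "\<O> = ?pre ` {W. openin Z W \<and> vanish W}"
  have "{0..1::real} \<times> topspace Y \<subseteq> \<Union>\<O>"
  proof
    fix p assume p: "p \<in> {0..1::real} \<times> topspace Y"
    then have p': "p \<in> topspace (prod_topology ?I Y)" by (simp add: topspace_prod_topology)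
    then have "h p \<in> topspace Z" using h(1) by (auto simp: continuous_map_def)
    then obtain W where "openin Z W" "h p \<in> W" "vanish W" using van by blast
    then show "p \<in> \<Union>\<O>" unfolding \<O>_def using p' by blast
  qed
  moreover have "openin (prod_topology ?I Y) G" if "G \<in> \<O>" for G
    using that h(1) by (auto simp: \<O>_def simp del: topspace_prod_topology intro!: openin_continuous_map_preimage)
  ultimately obtain \<epsilon> where \<epsilon>: "continuous_map Y euclideanreal \<epsilon>" "\<And>y. y \<in> topspace Y \<Longrightarrow> 0 < \<epsilon> y"
    "\<And>y s t. \<lbrakk>y \<in> topspace Y; s \<in> {0..1}; t \<in> {0..1}; \<bar>s - t\<bar> \<le> \<epsilon> y\<rbrakk> \<Longrightarrow>
       \<exists>G\<in>\<O>. (s, y) \<in> G \<and> (t, y) \<in> G"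
    using exists_lebesgue_function[OF Y] by metis
  \<comment> \<open>The outer \<open>max 0\<close> only keeps the time in \<open>[0, 1]\<close> for points outside \<open>Y\<close>.\<close>
  define \<tau> where "\<tau> k y = max 0 (min 1 (real k * \<epsilon> y))" for k y
  define f where "f k y = h (\<tau> k y, y)" for k y
  have \<tau>01: "\<tau> k y \<in> {0..1}" for k y by (auto simp: \<tau>_def)
  have "continuous_map Y Z (f k)" for k
  proof -
    have "continuous_map Y euclideanreal (\<tau> k)"
      unfolding \<tau>_def by (intro continuous_map_real_max continuous_map_real_min
          continuous_map_real_mult \<epsilon>(1)) auto
    then have "continuous_map Y (prod_topology ?I Y) (\<lambda>y. (\<tau> k y, y))"
      using \<tau>01 by (auto simp: continuous_map_in_subtopology intro!: continuous_map_pairedI)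
    from continuous_map_compose[OF this h(1)] show ?thesis by (simp add: f_def[abs_def] o_def)
  qed
  moreover have "continuous_map Y Z b"
    using assms(2) homotopic_with_imp_continuous_maps by blast
  moreover have "\<exists>U K. openin Y U \<and> y \<in> U \<and> (\<forall>k\<ge>K. \<forall>x\<in>U. f k x = b x)" if y: "y \<in> topspace Y" for y
  proof -
    let ?U = "{x \<in> topspace Y. \<epsilon> x \<in> {\<epsilon> y / 2<..}}"
    obtain K where K: "1 < real K * (\<epsilon> y / 2)"
      using reals_Archimedean3[of "\<epsilon> y / 2"] \<epsilon>(2)[OF y] half_gt_zero by blast
    have "f k x = b x" if "K \<le> k" "x \<in> ?U" for k x
    proof -
      have "real K * (\<epsilon> y / 2) \<le> real k * \<epsilon> x"
        using that \<epsilon>(2)[OF y] by (intro mult_mono) auto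
      then show ?thesis using K h(3) by (simp add: f_def \<tau>_def)
    qed
    moreover have "openin Y ?U"
      by (rule openin_continuous_map_preimage[OF \<epsilon>(1)]) auto
    ultimately show ?thesis using y \<epsilon>(2)[OF y] by (intro exI[of _ ?U] exI[of _ K]) auto
  qed
  moreover have "\<exists>W. openin Z W \<and> f k y \<in> W \<and> f (Suc k) y \<in> W \<and>
      (\<forall>zs\<in>tuples (Suc (Suc q)) Z. set zs \<subseteq> W \<longrightarrow> AS_delta (Suc q) Z \<phi> zs = 0)"
    if y: "y \<in> topspace Y" for y k
  proof -
    have "\<bar>\<tau> k y - \<tau> (Suc k) y\<bar> \<le> \<epsilon> y"
      using \<epsilon>(2)[OF y] by (auto simp: \<tau>_def max_def min_def algebra_simps)
    then obtain G where "G \<in> \<O>" "(\<tau> k y, y) \<in> G" "(\<tau> (Suc k) y, y) \<in> G"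
      using \<epsilon>(3)[OF y \<tau>01 \<tau>01] by blast
    then show ?thesis unfolding \<O>_def f_def vanish_def by blast
  qed
  ultimately have "(\<lambda>ys. AS_pullback (Suc q) Y b \<phi> ys - AS_pullback (Suc q) Y (f 0) \<phi> ys)
      \<in> AS_coboundaries (Suc q) Y"
    by (rule AS_pullback_sequence)
  moreover have "f 0 = a" by (auto simp: f_def \<tau>_def h(2))
  ultimately show ?thesis by simp
qed

lemma AS_pullback_compose:
  "continuous_map X Y f \<Longrightarrow> AS_pullback q X f (AS_pullback q Y g \<phi>) = AS_pullback q X (g \<circ> f) \<phi>"
  by (auto simp: AS_pullback_def fun_eq_iff map_tuples)

lemma AS_pullback_coboundary_homotopic:
  assumes Y: "metrizable_space Y" and ab: "homotopic_with (\<lambda>_. True) Y Z a b"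
    and \<phi>: "\<phi> \<in> AS_cocycles (Suc q) Z" and a: "AS_pullback (Suc q) Y a \<phi> \<in> AS_coboundaries (Suc q) Y"
  shows "AS_pullback (Suc q) Y b \<phi> \<in> AS_coboundaries (Suc q) Y"
  using coboundary_add[OF AS_pullback_homotopic[OF Y ab \<phi>] a] by simp

section \<open>Cup products and open covers\<close>

text \<open>
  If \<open>\<phi>\<close> restricts on \<open>U\<close> to \<open>\<delta> \<psi>\<close> up to a locally zero cochain, then \<open>\<psi>\<close> extends by zero to \<open>Y\<close>, because
  cochains are arbitrary functions. Subtracting the coboundary of this extension from \<open>\<phi>\<close> makes it
  locally zero at the points of \<open>U\<close> without changing its class.
\<close>

lemma AS_cocycle_vanishing_near_open:
  fixes \<phi> :: "'a list \<Rightarrow> 'r::ring_1"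
  assumes \<phi>: "\<phi> \<in> AS_cocycles q Y" and U: "openin Y U"
    and b: "AS_pullback q (subtopology Y U) id \<phi> \<in> AS_coboundaries q (subtopology Y U)"
  obtains \<phi>' where "\<phi>' \<in> AS_cocycles q Y" "AS_class q Y \<phi>' = AS_class q Y \<phi>"
    "\<And>x. x \<in> U \<Longrightarrow> \<exists>V. openin Y V \<and> x \<in> V \<and> (\<forall>xs\<in>tuples q Y. set xs \<subseteq> V \<longrightarrow> \<phi>' xs = 0)"
proof -
  let ?U = "subtopology Y U"
  have top: "topspace ?U = U" using U openin_subset[of Y U] by (auto simp: topspace_subtopology)
  have tup: "xs \<in> tuples p ?U \<longleftrightarrow> xs \<in> tuples p Y \<and> set xs \<subseteq> U" for p xs
    using openin_subset[OF U] by (auto simp: tuples_def)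
  have local: "\<exists>V. openin Y V \<and> x \<in> V \<and> V \<subseteq> U \<and> (\<forall>xs\<in>tuples p Y. set xs \<subseteq> V \<longrightarrow> \<zeta> xs = 0)"
    if \<zeta>: "\<zeta> \<in> AS_locally_zero p ?U" and x: "x \<in> U" for p x and \<zeta> :: "'a list \<Rightarrow> 'r"
  proof -
    obtain V where V: "openin ?U V" "x \<in> V" "\<forall>xs\<in>tuples p ?U. set xs \<subseteq> V \<longrightarrow> \<zeta> xs = 0"
      using \<zeta> x unfolding AS_locally_zero_iff top by blast
    moreover have "openin Y V" "V \<subseteq> U"
      using V(1) openin_open_subtopology[OF U] by auto
    moreover have "\<zeta> xs = 0" if "xs \<in> tuples p Y" "set xs \<subseteq> V" for xs
      using V(3) that \<open>V \<subseteq> U\<close> tup by auto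
    ultimately show ?thesis using V(2) by (intro exI[of _ V]) simp
  qed
  show thesis
  proof (cases q)
    case 0
    have "\<exists>V. openin Y V \<and> x \<in> V \<and> (\<forall>xs\<in>tuples q Y. set xs \<subseteq> V \<longrightarrow> \<phi> xs = 0)" if "x \<in> U" for x
    proof -
      have "AS_pullback q ?U id \<phi> \<in> AS_locally_zero q ?U"
        using b unfolding 0 AS_coboundaries_0 .
      from local[OF this that] obtain V where V: "openin Y V" "x \<in> V" "V \<subseteq> U"
        "\<forall>xs\<in>tuples q Y. set xs \<subseteq> V \<longrightarrow> AS_pullback q ?U id \<phi> xs = 0"
        by blast
      have "\<phi> xs = 0" if "xs \<in> tuples q Y" "set xs \<subseteq> V" for xs
      proof -
        have "xs \<in> tuples q ?U" using that V(3) by (auto simp: tup)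
        then show ?thesis using V(4) that by (auto simp: AS_pullback_def)
      qed
      with V(1,2) show ?thesis by blast
    qed
    with \<phi> show thesis using that by blast
  next
    case (Suc p)
    obtain \<psi> \<zeta> where \<psi>: "AS_pullback q ?U id \<phi> = (\<lambda>xs. AS_delta p ?U \<psi> xs + \<zeta> xs)"
      "\<psi> \<in> AS_cochains p ?U" "\<zeta> \<in> AS_locally_zero (Suc p) ?U"
      using b unfolding Suc AS_coboundaries_Suc by blast
    have \<psi>Y: "\<psi> \<in> AS_cochains p Y"
      using \<psi>(2) by (auto simp: AS_cochains_def tup)
    define \<phi>' where "\<phi>' xs = \<phi> xs + - AS_delta p Y \<psi> xs" for xs
    have cob: "(\<lambda>xs. - AS_delta p Y \<psi> xs) \<in> AS_coboundaries q Y"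
      unfolding Suc by (intro coboundary_uminus delta_coboundary \<psi>Y)
    have 1: "\<phi>' \<in> AS_cocycles q Y"
      unfolding \<phi>'_def using cob coboundaries_subset_cocycles by (intro cocycle_add \<phi>) auto
    have 2: "AS_class q Y \<phi>' = AS_class q Y \<phi>"
      by (rule AS_class_eqI) (simp add: \<phi>'_def cob)
    have "\<exists>V. openin Y V \<and> x \<in> V \<and> (\<forall>xs\<in>tuples q Y. set xs \<subseteq> V \<longrightarrow> \<phi>' xs = 0)" if x: "x \<in> U" for x
    proof -
      obtain V where V: "openin Y V" "x \<in> V" "V \<subseteq> U"
        "\<And>xs. xs \<in> tuples q Y \<Longrightarrow> set xs \<subseteq> V \<Longrightarrow> \<zeta> xs = 0"
        using local[OF \<psi>(3) x] unfolding Suc by blast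
      have "\<phi>' xs = 0" if xs: "xs \<in> tuples q Y" "set xs \<subseteq> V" for xs
      proof -
        have xsU: "xs \<in> tuples q ?U" using xs V(3) by (auto simp: tup)
        have "\<phi> xs = AS_delta p ?U \<psi> xs"
          using fun_cong[OF \<psi>(1), of xs] V(4)[OF xs] xsU by (simp add: AS_pullback_def)
        also have "\<dots> = AS_delta p Y \<psi> xs"
          using xsU xs by (simp add: AS_delta_def Suc)
        finally show ?thesis by (simp add: \<phi>'_def)
      qed
      with V(1,2) show ?thesis by blast
    qed
    with 1 2 show thesis using that by blast
  qed
qed

text \<open>
  With representatives that vanish near the points of \<open>U\<close> and of \<open>V\<close> respectively, one of the two factors of
  the cup product vanishes near any given point.
\<close>

lemma AS_cup_open_cover:
  fixes \<phi> \<psi> :: "'a list \<Rightarrow> 'r::ring_1"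
  assumes \<phi>: "\<phi> \<in> AS_cocycles p Y" and \<psi>: "\<psi> \<in> AS_cocycles q Y"
    and U: "openin Y U" and V: "openin Y V" and cover: "topspace Y \<subseteq> U \<union> V"
    and \<phi>U: "AS_pullback p (subtopology Y U) id \<phi> \<in> AS_coboundaries p (subtopology Y U)"
    and \<psi>V: "AS_pullback q (subtopology Y V) id \<psi> \<in> AS_coboundaries q (subtopology Y V)"
  shows "AS_cup p q Y (AS_class p Y \<phi>) (AS_class q Y \<psi>) = \<one>\<^bsub>AS_cohomology (p + q) Y\<^esub>"
proof -
  obtain \<phi>' where \<phi>': "\<phi>' \<in> AS_cocycles p Y" "AS_class p Y \<phi>' = AS_class p Y \<phi>"
    "\<And>x. x \<in> U \<Longrightarrow> \<exists>N. openin Y N \<and> x \<in> N \<and> (\<forall>xs\<in>tuples p Y. set xs \<subseteq> N \<longrightarrow> \<phi>' xs = 0)"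
    using AS_cocycle_vanishing_near_open[OF \<phi> U \<phi>U] by blast
  obtain \<psi>' where \<psi>': "\<psi>' \<in> AS_cocycles q Y" "AS_class q Y \<psi>' = AS_class q Y \<psi>"
    "\<And>x. x \<in> V \<Longrightarrow> \<exists>N. openin Y N \<and> x \<in> N \<and> (\<forall>xs\<in>tuples q Y. set xs \<subseteq> N \<longrightarrow> \<psi>' xs = 0)"
    using AS_cocycle_vanishing_near_open[OF \<psi> V \<psi>V] by blast
  have "AS_cup_cochain p q Y \<phi>' \<psi>' \<in> AS_locally_zero (p + q) Y"
    unfolding AS_locally_zero_iff
  proof (intro conjI ballI AS_cup_cochain_in)
    fix x assume x: "x \<in> topspace Y"
    have "x \<in> U \<or> x \<in> V" using cover x by blast
    then have "\<exists>N. openin Y N \<and> x \<in> N \<and> ((\<forall>xs\<in>tuples p Y. set xs \<subseteq> N \<longrightarrow> \<phi>' xs = 0) \<or>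
        (\<forall>xs\<in>tuples q Y. set xs \<subseteq> N \<longrightarrow> \<psi>' xs = 0))"
      using \<phi>'(3) \<psi>'(3) by metis
    then obtain N where N: "openin Y N" "x \<in> N" "(\<forall>xs\<in>tuples p Y. set xs \<subseteq> N \<longrightarrow> \<phi>' xs = 0) \<or>
        (\<forall>xs\<in>tuples q Y. set xs \<subseteq> N \<longrightarrow> \<psi>' xs = 0)"
      by blast
    have "AS_cup_cochain p q Y \<phi>' \<psi>' xs = 0" if "xs \<in> tuples (p + q) Y" "set xs \<subseteq> N" for xs
      using N(3) take_drop_tuples[OF that(1)] that(2) set_take_subset[of "Suc p" xs]
        set_drop_subset[of p xs]
      by (auto simp: AS_cup_cochain_def)
    with N show "\<exists>N. openin Y N \<and> x \<in> N \<and>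
        (\<forall>xs\<in>tuples (p + q) Y. set xs \<subseteq> N \<longrightarrow> AS_cup_cochain p q Y \<phi>' \<psi>' xs = 0)"
      by blast
  qed
  then have "AS_class (p + q) Y (AS_cup_cochain p q Y \<phi>' \<psi>') = AS_class (p + q) Y (\<lambda>_. 0)"
    by (intro AS_class_eqI) (simp add: locally_zero_coboundary)
  then show ?thesis
    using AS_cup_class[OF \<phi>'(1) \<psi>'(1)] by (simp add: \<phi>'(2) \<psi>'(2) one_AS_cohomology)
qed

section \<open>Dirac measures and atoms in the Levy--Prokhorov metric\<close>

lemma mtopology_fin_measures:
  "mtopology_of (fin_measures_metric n m) = Metric_space.mtopology (fin_measures n (mspace m)) (LP_dist m)"
  by (simp add: mtopology_of_def)

lemma LP_dist_commute: "LP_dist m \<mu> \<nu> = LP_dist m \<nu> \<mu>"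
  by (simp add: LP_dist_def LP_good_commute[of m \<mu> \<nu>])

lemma singleton_borel:
  assumes "x \<in> mspace m"
  shows "{x} \<in> sigma_sets (mspace m) {U. openin (mtopology_of m) U}"
proof -
  have "closedin (mtopology_of m) {x}"
    using assms by (intro closedin_Hausdorff_singleton)
      (simp_all add: mtopology_of_def Metric_space.Hausdorff_space_mtopology
        Metric_space.topspace_mtopology)
  then have "mspace m - (mspace m - {x}) \<in> sigma_sets (mspace m) {U. openin (mtopology_of m) U}"
    by (intro sigma_sets.Compl sigma_sets.Basic) (simp add: closedin_def)
  moreover have "mspace m - (mspace m - {x}) = {x}" using assms by auto
  ultimately show ?thesis by simp
qed

text \<open>
  The Levy--Prokhorov condition, applied to the singleton \<open>{x}\<close>, forces mass near \<open>x\<close> in every measure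
  close to \<open>\<mu>\<close>.
\<close>

lemma LP_close_mass:
  assumes "LP_dist m \<mu> \<nu> < e" "x \<in> mspace m"
  shows "pmf \<mu> x < measure_pmf.prob \<nu> (metric_nbhd m {x} e \<inter> set_pmf \<nu>) + e"
proof -
  obtain e' where e': "LP_dist m \<mu> \<nu> < e'" "e' < e" using dense[OF assms(1)] by blast
  have "pmf \<mu> x \<le> measure_pmf.prob \<nu> (metric_nbhd m {x} e') + e'"
    using LP_dist_less[OF e'(1)] singleton_borel[OF assms(2)]
    unfolding LP_good_def by (simp add: measure_pmf_single[symmetric])
  also have "measure_pmf.prob \<nu> (metric_nbhd m {x} e') \<le> measure_pmf.prob \<nu> (metric_nbhd m {x} e)"
    using e'(2) by (intro measure_pmf.finite_measure_mono metric_nbhd_mono) auto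
  finally show ?thesis using e'(2) by (simp add: measure_Int_set_pmf)
qed

lemma LP_close_atom:
  assumes "LP_dist m \<mu> \<nu> < e" "x \<in> mspace m" "e \<le> pmf \<mu> x"
  obtains y where "y \<in> set_pmf \<nu>" "mdist m x y < e"
proof -
  have "metric_nbhd m {x} e \<inter> set_pmf \<nu> \<noteq> {}"
    using LP_close_mass[OF assms(1,2)] assms(3) by auto
  then show thesis using that by (auto simp: metric_nbhd_def)
qed

lemma LP_close_Dirac:
  assumes "LP_dist m \<mu> (return_pmf z) < e" "x \<in> mspace m" "e \<le> pmf \<mu> x"
  shows "mdist m x z < e"
  using LP_close_atom[OF assms] by (metis set_return_pmf singletonD)

lemma LP_dist_return_le:
  assumes "x \<in> mspace m" "y \<in> mspace m"
  shows "LP_dist m (return_pmf x) (return_pmf y) \<le> mdist m x y"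
proof (rule field_le_epsilon)
  fix e :: real assume "e > 0"
  have "LP_good m (return_pmf x) (return_pmf y) (mdist m x y + e)"
    unfolding LP_good_def
  proof (intro conjI ballI)
    show pos: "0 < mdist m x y + e" using \<open>e > 0\<close> by (simp add: add_nonneg_pos)
    fix A assume "A \<in> sigma_sets (mspace m) {U. openin (mtopology_of m) U}"
    have "y \<in> metric_nbhd m A (mdist m x y + e)" if "x \<in> A"
      unfolding metric_nbhd_def using that assms \<open>e > 0\<close> by (auto intro: bexI[of _ x])
    moreover have "x \<in> metric_nbhd m A (mdist m x y + e)" if "y \<in> A"
      unfolding metric_nbhd_def using that assms \<open>e > 0\<close> mdist_commute[of m x y]
      by (auto intro: bexI[of _ y])
    ultimately show
      "measure_pmf.prob (return_pmf x) A \<le>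
        measure_pmf.prob (return_pmf y) (metric_nbhd m A (mdist m x y + e)) + (mdist m x y + e)"
      "measure_pmf.prob (return_pmf y) A \<le>
        measure_pmf.prob (return_pmf x) (metric_nbhd m A (mdist m x y + e)) + (mdist m x y + e)"
      using pos by (auto simp: measure_return_pmf indicator_def)
  qed
  then show "LP_dist m (return_pmf x) (return_pmf y) \<le> mdist m x y + e" by (rule LP_dist_le)
qed

abbreviation Diracs :: "'a metric \<Rightarrow> 'a pmf set" where
  "Diracs m \<equiv> return_pmf ` mspace m"

lemma Diracs_subset: "1 \<le> n \<Longrightarrow> Diracs m \<subseteq> fin_measures n (mspace m)"
  by (auto simp: fin_measures_def)

lemma not_Dirac_atoms:
  assumes "\<mu> \<in> fin_measures n (mspace m)" "\<mu> \<notin> Diracs m"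
  obtains x y where "x \<in> set_pmf \<mu>" "y \<in> set_pmf \<mu>" "x \<noteq> y"
proof -
  obtain x where x: "x \<in> set_pmf \<mu>" using set_pmf_not_empty[of \<mu>] by blast
  moreover have "\<not> set_pmf \<mu> \<subseteq> {x}"
    using assms x by (auto simp: set_pmf_subset_singleton fin_measures_def)
  ultimately show thesis using that by blast
qed

text \<open>
  Two distinct atoms of a measure would both be close to the only atom of a close Dirac measure.
\<close>

lemma closedin_Diracs:
  assumes "1 \<le> n"
  shows "closedin (mtopology_of (fin_measures_metric n m)) (Diracs m)"
proof -
  let ?B = "fin_measures n (mspace m)"
  interpret B: Metric_space ?B "LP_dist m" by (rule Metric_space_fin_measures)
  have "\<exists>r>0. B.mball \<mu> r \<subseteq> ?B - Diracs m" if \<mu>: "\<mu> \<in> ?B - Diracs m" for \<mu>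
  proof -
    obtain x y where xy: "x \<in> set_pmf \<mu>" "y \<in> set_pmf \<mu>" "x \<noteq> y"
      by (rule not_Dirac_atoms[of \<mu> n m]) (use \<mu> in auto)
    have xy_m: "x \<in> mspace m" "y \<in> mspace m" using xy \<mu> by (auto simp: fin_measures_def)
    define r where "r = min (min (pmf \<mu> x) (pmf \<mu> y)) (mdist m x y / 2)"
    have "0 < mdist m x y" using xy_m xy(3) mdist_zero[of x m y] mdist_nonneg[of m x y] by linarith
    then have r: "r > 0" using xy by (simp add: r_def pmf_positive)
    have "LP_dist m \<mu> (return_pmf z) \<ge> r" if z: "z \<in> mspace m" for z
    proof (rule ccontr)
      assume "\<not> ?thesis"
      then have *: "LP_dist m \<mu> (return_pmf z) < r" by simp
      have "mdist m x z < r" "mdist m y z < r"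
        by (rule LP_close_Dirac[OF *]; simp add: xy_m r_def)+
      then show False
        using mdist_triangle[OF xy_m(1) z xy_m(2)] mdist_commute[of m y z] by (simp add: r_def)
    qed
    then have "B.mball \<mu> r \<subseteq> ?B - Diracs m" by (fastforce simp: B.mball_def)
    with r show ?thesis by blast
  qed
  then have "openin B.mtopology (?B - Diracs m)" by (auto simp: B.openin_mtopology)
  then show ?thesis
    using Diracs_subset[OF assms] by (simp add: mtopology_fin_measures closedin_def)
qed

lemma homeomorphic_maps_return_pmf:
  assumes "1 \<le> n"
  shows "homeomorphic_maps (mtopology_of m)
    (subtopology (mtopology_of (fin_measures_metric n m)) (Diracs m)) return_pmf
    (inv_into (mspace m) return_pmf)"
proof -
  let ?B = "fin_measures n (mspace m)" and ?j = "inv_into (mspace m) return_pmf"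
  interpret B: Metric_space ?B "LP_dist m" by (rule Metric_space_fin_measures)
  interpret M: Metric_space "mspace m" "mdist m" by simp
  have j: "?j (return_pmf x) = x" if "x \<in> mspace m" for x
    using that by (intro inv_into_f_f) (auto simp: inj_on_def)
  have "continuous_map M.mtopology B.mtopology return_pmf"
    unfolding M.metric_continuous_map[OF B.Metric_space_axioms]
  proof (intro conjI ballI allI impI)
    fix x e assume "x \<in> mspace m" "(e::real) > 0"
    then show "\<exists>\<delta>>0. \<forall>y. y \<in> mspace m \<and> mdist m x y < \<delta> \<longrightarrow>
        LP_dist m (return_pmf x) (return_pmf y) < e"
      using LP_dist_return_le[of x m] by (intro exI[of _ e]) fastforce
  qed (rule Diracs_subset[OF assms])
  moreover have "continuous_map (subtopology B.mtopology (Diracs m)) M.mtopology ?j"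
    unfolding M.continuous_map_to_metric
  proof (intro ballI allI impI)
    fix \<mu> and e :: real assume "\<mu> \<in> topspace (subtopology B.mtopology (Diracs m))" "e > 0"
    then obtain x where x: "x \<in> mspace m" "\<mu> = return_pmf x" "\<mu> \<in> ?B" by auto
    \<comment> \<open>The bound 1 is the weight of the atom \<open>x\<close>, up to which it forces a close atom.\<close>
    let ?U = "Diracs m \<inter> B.mball \<mu> (min e 1)"
    have "mdist m x y < e" if y: "y \<in> mspace m" "LP_dist m \<mu> (return_pmf y) < min e 1" for y
      using LP_close_atom[OF y(2) x(1)] x(2) by auto
    then have "\<forall>\<nu>\<in>?U. ?j \<nu> \<in> M.mball (?j \<mu>) e"
      using x j by (auto simp: B.mball_def M.mball_def)
    moreover have "openin (subtopology B.mtopology (Diracs m)) ?U"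
      by (simp add: openin_subtopology_Int2)
    moreover have "\<mu> \<in> ?U" using x \<open>e > 0\<close> by simp
    ultimately show "\<exists>U. openin (subtopology B.mtopology (Diracs m)) U \<and> \<mu> \<in> U \<and>
        (\<forall>\<nu>\<in>U. ?j \<nu> \<in> M.mball (?j \<mu>) e)" by blast
  qed
  ultimately show ?thesis
    using j by (auto simp: homeomorphic_maps_def mtopology_fin_measures continuous_map_in_subtopology
        mtopology_of_def)
qed

lemma fin_measures_2_support:
  assumes "\<nu> \<in> fin_measures n S" "n \<le> 2"
  obtains u v where "set_pmf \<nu> = {u, v}" "u \<in> S" "v \<in> S"
proof -
  have fin: "finite (set_pmf \<nu>)" "card (set_pmf \<nu>) \<le> 2" "set_pmf \<nu> \<subseteq> S"
    using assms by (auto simp: fin_measures_def)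
  moreover have "card (set_pmf \<nu>) \<noteq> 0" using fin set_pmf_not_empty[of \<nu>] by auto
  ultimately have "card (set_pmf \<nu>) = 1 \<or> card (set_pmf \<nu>) = 2" by linarith
  then obtain u v where "set_pmf \<nu> = {u, v}" by (auto simp: card_1_singleton_iff card_2_iff)
  then show thesis using that fin(3) by blast
qed

text \<open>
  Two atoms \<open>u\<close> and \<open>v\<close> of \<open>\<mu>\<close> force disjoint neighbourhoods of mass at least \<open>c\<close> each in a close
  measure; having at most two atoms, that measure has exactly one in each of them.
\<close>

lemma not_Dirac_near:
  assumes \<mu>: "\<mu> \<in> fin_measures n (mspace m)" "\<mu> \<notin> Diracs m" and n: "n \<le> 2"
  obtains e c where "e > 0" "c > 0"
    "\<And>\<nu>. \<lbrakk>\<nu> \<in> fin_measures n (mspace m); LP_dist m \<mu> \<nu> < e\<rbrakk> \<Longrightarrow>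
       \<nu> \<notin> Diracs m \<and> (\<forall>a\<in>set_pmf \<nu>. c \<le> pmf \<nu> a)"
proof -
  obtain u v where uv: "u \<in> set_pmf \<mu>" "v \<in> set_pmf \<mu>" "u \<noteq> v"
    by (rule not_Dirac_atoms[OF \<mu>])
  have uv_m: "u \<in> mspace m" "v \<in> mspace m" using uv \<mu>(1) by (auto simp: fin_measures_def)
  \<comment> \<open>A neighbourhood of an atom loses at most \<open>e \<le> c\<close> of the mass of the atom, which is at least \<open>2 * c\<close>;
    half the distance from \<open>u\<close> to \<open>v\<close> keeps the two neighbourhoods disjoint.\<close>
  define c where "c = min (pmf \<mu> u) (pmf \<mu> v) / 2"
  define e where "e = min c (mdist m u v / 2)"
  have "0 < mdist m u v" using uv_m uv(3) mdist_zero[of u m v] mdist_nonneg[of m u v] by linarith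
  moreover have c: "c > 0" using uv by (simp add: c_def pmf_positive)
  ultimately have e: "e > 0" by (simp add: e_def)
  have le: "e \<le> c" by (simp add: e_def)
  have c_le: "2 * c \<le> pmf \<mu> u" "2 * c \<le> pmf \<mu> v" by (simp_all add: c_def)
  have "\<nu> \<notin> Diracs m \<and> (\<forall>a\<in>set_pmf \<nu>. c \<le> pmf \<nu> a)"
    if \<nu>: "\<nu> \<in> fin_measures n (mspace m)" "LP_dist m \<mu> \<nu> < e" for \<nu>
  proof -
    have mass: "c < measure_pmf.prob \<nu> (metric_nbhd m {u} e \<inter> set_pmf \<nu>)"
      "c < measure_pmf.prob \<nu> (metric_nbhd m {v} e \<inter> set_pmf \<nu>)"
      using LP_close_mass[OF \<nu>(2) uv_m(1)] LP_close_mass[OF \<nu>(2) uv_m(2)] le c_le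
      by linarith+
    have disj: "metric_nbhd m {u} e \<inter> metric_nbhd m {v} e = {}"
    proof (rule ccontr)
      assume "\<not> ?thesis"
      then obtain z where "z \<in> mspace m" "mdist m u z < e" "mdist m v z < e"
        by (auto simp: metric_nbhd_def)
      then show False
        using mdist_triangle[OF uv_m(1) _ uv_m(2), of z] mdist_commute[of m v z]
        by (simp add: e_def)
    qed
    have "metric_nbhd m {u} e \<inter> set_pmf \<nu> \<noteq> {}" "metric_nbhd m {v} e \<inter> set_pmf \<nu> \<noteq> {}"
      using mass c by auto
    then obtain a b where ab: "a \<in> metric_nbhd m {u} e" "b \<in> metric_nbhd m {v} e"
      "a \<in> set_pmf \<nu>" "b \<in> set_pmf \<nu>" by blast
    then have "a \<noteq> b" using disj by blast
    obtain a' b' where "set_pmf \<nu> = {a', b'}"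
      by (rule fin_measures_2_support[OF \<nu>(1) n])
    then have supp: "set_pmf \<nu> = {a, b}" using ab \<open>a \<noteq> b\<close> by auto
    have "metric_nbhd m {u} e \<inter> set_pmf \<nu> = {a}" "metric_nbhd m {v} e \<inter> set_pmf \<nu> = {b}"
      using supp ab disj by auto
    then have "c < pmf \<nu> a" "c < pmf \<nu> b" using mass by (simp_all add: measure_pmf_single)
    moreover have "\<nu> \<notin> Diracs m" using supp \<open>a \<noteq> b\<close> by auto
    ultimately show ?thesis using supp by auto
  qed
  then show thesis using that e c by blast
qed

section \<open>Neighbourhood retractions onto an ANR\<close>

text \<open>
  The definition of an ANR speaks about ambient spaces on the type \<open>'a \<Rightarrow> real\<close> only. The injection \<open>e\<close>
  carries the topology of \<open>B\<close> over to that type; for spaces of measures it is \<open>pmf\<close>.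
\<close>

lemma ANR_space_neighbourhood_retraction:
  fixes X :: "'a topology" and B :: "'b topology" and e :: "'b \<Rightarrow> 'a \<Rightarrow> real"
  assumes X: "ANR_space X" and B: "metrizable_space B" and e: "inj_on e (topspace B)"
    and S: "closedin B S" and ij: "homeomorphic_maps X (subtopology B S) i j"
  obtains W r where "openin B W" "S \<subseteq> W" "continuous_map (subtopology B W) X r"
    "\<And>x. x \<in> topspace X \<Longrightarrow> r (i x) = x"
proof -
  let ?T = "topspace B" 
  let ?e' = "inv_into ?T e"
  define Z where "Z = pullback_topology (e ` ?T) ?e' B"
  have e': "?e' (e b) = b" if "b \<in> ?T" for b using e that by simp
  have S_T: "S \<subseteq> ?T" using closedin_subset[OF S] .
  have "continuous_map Z B ?e'"
    using continuous_map_pullback[OF continuous_map_id, where A = "e ` ?T" and f = ?e' and ?T1.0 = B] by (simp add: Z_def)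
  moreover have "continuous_map B Z e"
    unfolding Z_def
  proof (rule continuous_map_pullback')
    show "continuous_map B B (?e' \<circ> e)"
      using continuous_map_id[of B] by (rule continuous_map_eq) (simp add: e')
  qed auto
  moreover have top_Z: "topspace Z = e ` ?T"
    by (auto simp: Z_def topspace_pullback_topology e')
  ultimately have eZ: "homeomorphic_maps B Z e ?e'"
    by (auto simp: homeomorphic_maps_def e')
  then have e_hom: "homeomorphic_map B Z e" using homeomorphic_maps_map by blast
  have Z: "metrizable_space Z"
    using B homeomorphic_metrizable_space homeomorphic_map_imp_homeomorphic_space[OF e_hom] by blast
  have eS: "closedin Z (e ` S)"
    using homeomorphic_map_closedness[OF e_hom S_T] S by simp
  have "homeomorphic_map (subtopology B S) (subtopology Z (e ` S)) e"
    using S_T e by (intro homeomorphic_map_subtopologies[OF e_hom]) (auto simp: top_Z inj_on_def)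
  then have "subtopology Z (e ` S) homeomorphic_space X"
    using ij homeomorphic_map_imp_homeomorphic_space homeomorphic_space_sym homeomorphic_space_trans
      homeomorphic_maps_imp_homeomorphic_space by meson
  then obtain U where U: "openin Z U" "e ` S \<subseteq> U" "(e ` S) retract_of_space (subtopology Z U)"
    using X Z eS unfolding ANR_space_def by blast
  then obtain \<rho> where \<rho>: "continuous_map (subtopology Z U) (subtopology (subtopology Z U) (e ` S)) \<rho>"
    "\<And>z. z \<in> e ` S \<Longrightarrow> \<rho> z = z"
    unfolding retract_of_space_def by blast
  define W where "W = {b \<in> ?T. e b \<in> U}"
  have eB: "continuous_map B Z e" "continuous_map Z B ?e'" using eZ by (auto simp: homeomorphic_maps_def)
  have "openin B W" unfolding W_def by (rule openin_continuous_map_preimage[OF eB(1) U(1)])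
  moreover have "S \<subseteq> W" using U(2) S_T by (auto simp: W_def)
  moreover have "continuous_map (subtopology B W) X (j \<circ> (?e' \<circ> (\<rho> \<circ> e)))"
  proof (rule continuous_map_compose)
    show "continuous_map (subtopology B S) X j" using ij by (simp add: homeomorphic_maps_def)
    have "continuous_map (subtopology B W) (subtopology Z U) e"
      using eB(1) by (auto simp: continuous_map_in_subtopology W_def continuous_map_from_subtopology)
    then have c: "continuous_map (subtopology B W) (subtopology (subtopology Z U) (e ` S)) (\<rho> \<circ> e)"
      using \<rho>(1) by (rule continuous_map_compose)
    then have "continuous_map (subtopology B W) Z (\<rho> \<circ> e)" and
      im: "(\<rho> \<circ> e) ` topspace (subtopology B W) \<subseteq> e ` S"
      by (auto simp: continuous_map_in_subtopology image_subset_iff Pi_iff)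
    then have "continuous_map (subtopology B W) B (?e' \<circ> (\<rho> \<circ> e))"
      using eB(2) by (blast intro: continuous_map_compose)
    moreover have "(?e' \<circ> (\<rho> \<circ> e)) ` topspace (subtopology B W) \<subseteq> S"
    proof
      fix y assume "y \<in> (?e' \<circ> (\<rho> \<circ> e)) ` topspace (subtopology B W)"
      then obtain b where "b \<in> topspace (subtopology B W)" "y = ?e' (\<rho> (e b))" by auto
      moreover from this im obtain s where "s \<in> S" "\<rho> (e b) = e s" by fastforce
      ultimately show "y \<in> S" using e' S_T by auto
    qed
    ultimately show "continuous_map (subtopology B W) (subtopology B S) (?e' \<circ> (\<rho> \<circ> e))"
      by (auto simp: continuous_map_in_subtopology)
  qed
  moreover have "(j \<circ> (?e' \<circ> (\<rho> \<circ> e))) (i x) = x" if x: "x \<in> topspace X" for x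
  proof -
    have "i x \<in> S" "j (i x) = x"
      using ij x by (auto simp: homeomorphic_maps_def continuous_map_def)
    then show ?thesis using \<rho>(2)[of "e (i x)"] e' S_T by auto
  qed
  ultimately show thesis using that by blast
qed

section \<open>The unordered pair of atoms\<close>

text \<open>
  For \<open>\<nu>\<close> with support \<open>{u, v}\<close> this is the point \<open>[(x, u), (x, v)]\<close> of the symmetric square; it is of
  interest only for measures with one or two atoms.
\<close>

definition supp_pair :: "'a \<Rightarrow> 'a pmf \<Rightarrow> ('a \<times> 'a) uprod" where
  "supp_pair x \<nu> = (SOME p. set_uprod p = Pair x ` set_pmf \<nu>)"

lemma supp_pair_eq:
  assumes "set_pmf \<nu> = {u, v}"
  shows "supp_pair x \<nu> = Upair (x, u) (x, v)"
  unfolding supp_pair_def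
proof (rule some_equality)
  fix p :: "('a \<times> 'a) uprod" assume "set_uprod p = Pair x ` set_pmf \<nu>"
  then show "p = Upair (x, u) (x, v)"
    using assms by (cases p) (auto simp: doubleton_eq_iff)
qed (simp add: assms)

text \<open>
  The lower bound \<open>c\<close> on the weights of \<open>\<nu>\<close> excludes a light atom far away from the support of \<open>\<nu>0\<close>. Such
  an atom can occur only if \<open>\<nu>0\<close> is a Dirac measure: otherwise \<open>\<nu>\<close> needs one atom close to each of the two
  atoms of \<open>\<nu>0\<close>, which leaves no room for another one.
\<close>

lemma supp_pair_near:
  assumes \<nu>0: "\<nu>0 \<in> fin_measures n (mspace m)" and n: "n \<le> 2" and x0: "x0 \<in> mspace m" and c: "c > 0"
    and G: "openin (SP2 (prod_topology (mtopology_of m) (mtopology_of m))) G" "supp_pair x0 \<nu>0 \<in> G"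
  obtains e where "e > 0" "\<And>x \<nu>. \<lbrakk>x \<in> mspace m; \<nu> \<in> fin_measures n (mspace m); mdist m x0 x < e;
      LP_dist m \<nu>0 \<nu> < e; \<And>a. a \<in> set_pmf \<nu> \<Longrightarrow> c \<le> pmf \<nu> a\<rbrakk> \<Longrightarrow> supp_pair x \<nu> \<in> G"
proof -
  let ?X = "mtopology_of m"
  interpret M: Metric_space "mspace m" "mdist m" by simp
  have X: "?X = M.mtopology" by (simp add: mtopology_of_def)
  obtain u v where uv: "set_pmf \<nu>0 = {u, v}" "u \<in> mspace m" "v \<in> mspace m"
      by (rule fin_measures_2_support[OF \<nu>0 n])
  let ?XX = "prod_topology ?X ?X"
  let ?P = "{p \<in> topspace (prod_topology ?XX ?XX). case_prod Upair p \<in> G}"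
  have "openin (prod_topology ?XX ?XX) ?P" using G(1) by (simp only: openin_SP2)
  moreover have "((x0, u), (x0, v)) \<in> ?P"
    using G(2) uv x0 by (simp add: supp_pair_eq)
  ultimately obtain C D where CD: "openin ?XX C" "openin ?XX D" "(x0, u) \<in> C" "(x0, v) \<in> D"
      "C \<times> D \<subseteq> ?P"
    unfolding openin_prod_topology_alt[of ?XX ?XX] by meson
  have ball: "\<exists>e>0. \<forall>x y. x \<in> mspace m \<and> y \<in> mspace m \<and> mdist m x0 x < e \<and> mdist m w y < e \<longrightarrow> (x, y) \<in> C"
    if C: "openin ?XX C" "(x0, w) \<in> C" for w C
  proof -
    obtain A B where AB: "openin ?X A" "openin ?X B" "x0 \<in> A" "w \<in> B" "A \<times> B \<subseteq> C"
      using C unfolding openin_prod_topology_alt by meson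
    obtain a b where "a > 0" "M.mball x0 a \<subseteq> A" "b > 0" "M.mball w b \<subseteq> B"
      using AB(1-4) unfolding X M.openin_mtopology by meson
    moreover have "x0 \<in> mspace m" "w \<in> mspace m"
      using AB(1-4) openin_subset[of ?X] by auto
    ultimately have "x \<in> A" "y \<in> B"
      if "x \<in> mspace m" "y \<in> mspace m" "mdist m x0 x < min a b" "mdist m w y < min a b" for x y
      using that by (auto simp: subset_iff)
    with \<open>a > 0\<close> \<open>b > 0\<close> AB(5) show ?thesis by (intro exI[of _ "min a b"]) auto
  qed
  obtain e1 where e1: "e1 > 0" "\<And>x y. \<lbrakk>x \<in> mspace m; y \<in> mspace m; mdist m x0 x < e1; mdist m u y < e1\<rbrakk> \<Longrightarrow> (x, y) \<in> C"
    using ball[OF CD(1,3)] by blast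
  obtain e2 where e2: "e2 > 0" "\<And>x y. \<lbrakk>x \<in> mspace m; y \<in> mspace m; mdist m x0 x < e2; mdist m v y < e2\<rbrakk> \<Longrightarrow> (x, y) \<in> D"
    using ball[OF CD(2,4)] by blast
  \<comment> \<open>For distinct \<open>u\<close> and \<open>v\<close>, radius \<open>sep\<close> prevents one atom of \<open>\<nu>\<close> from being close to both.\<close>
  define sep where "sep = (if u = v then 1 else mdist m u v / 2)"
  have "0 < mdist m u v" if "u \<noteq> v"
    using uv that mdist_zero[of u m v] mdist_nonneg[of m u v] by linarith
  then have sep: "sep > 0" by (simp add: sep_def)
  define e where "e = Min {e1, e2, c, pmf \<nu>0 u, pmf \<nu>0 v, sep}"
  have e: "e \<le> e1" "e \<le> e2" "e \<le> c" "e \<le> pmf \<nu>0 u" "e \<le> pmf \<nu>0 v" "e \<le> sep"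
    unfolding e_def by (rule Min_le; simp)+
  have "e > 0" using e1(1) e2(1) c sep uv by (simp add: e_def pmf_positive)
  moreover have "supp_pair x \<nu> \<in> G"
    if x: "x \<in> mspace m" "mdist m x0 x < e"
      and \<nu>: "\<nu> \<in> fin_measures n (mspace m)" "LP_dist m \<nu>0 \<nu> < e"
      and atoms: "\<And>a. a \<in> set_pmf \<nu> \<Longrightarrow> c \<le> pmf \<nu> a" for x \<nu>
  proof -
    obtain a b where ab: "set_pmf \<nu> = {a, b}" "a \<in> mspace m" "b \<in> mspace m"
      by (rule fin_measures_2_support[OF \<nu>(1) n])
    have in_G: "supp_pair x \<nu> \<in> G" if "set_pmf \<nu> = {a, b}" "mdist m u a < e" "mdist m v b < e" for a b
    proof -
      have "a \<in> mspace m" "b \<in> mspace m" using that \<nu>(1) by (auto simp: fin_measures_def)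
      then have "(x, a) \<in> C" "(x, b) \<in> D" using x that(2,3) e(1,2) by (auto intro!: e1(2) e2(2))
      then have "((x, a), (x, b)) \<in> ?P" using CD(5) by blast
      then show ?thesis by (simp add: supp_pair_eq[OF that(1)])
    qed
    obtain a1 where a1: "a1 \<in> set_pmf \<nu>" "mdist m u a1 < e"
      using LP_close_atom[OF \<nu>(2) uv(2) e(4)] by blast
    obtain b1 where b1: "b1 \<in> set_pmf \<nu>" "mdist m v b1 < e"
      using LP_close_atom[OF \<nu>(2) uv(3) e(5)] by blast
    show ?thesis
    proof (cases "u = v")
      case True
      have "mdist m u w < e" if w: "w \<in> set_pmf \<nu>" for w
      proof -
        have "w \<in> mspace m" using w ab by auto
        moreover have "e \<le> pmf \<nu> w" using atoms[OF w] e(3) by linarith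
        moreover have "LP_dist m \<nu> \<nu>0 < e" using \<nu>(2) by (simp add: LP_dist_commute)
        ultimately obtain y where "y \<in> set_pmf \<nu>0" "mdist m w y < e"
          using LP_close_atom by metis
        then show ?thesis using uv(1) True mdist_commute[of m] by simp
      qed
      then have "mdist m u a < e" "mdist m u b < e" using ab(1) by auto
      then show ?thesis using in_G[OF ab(1)] True by simp
    next
      case False
      have "a1 \<noteq> b1"
      proof
        assume "a1 = b1"
        then have "mdist m u v < 2 * e"
          using mdist_triangle[of u m a1 v] a1 b1 uv ab mdist_commute[of m v a1] by auto
        then show False using e(6) False by (simp add: sep_def)
      qed
      then have "set_pmf \<nu> = {a1, b1}" using ab(1) a1(1) b1(1) by auto
      then show ?thesis using in_G a1(2) b1(2) by blast
    qed
  qed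
  ultimately show thesis using that by blast
qed

lemma continuous_map_diagonal_SP2: "continuous_map Y (SP2 Y) (\<lambda>p. Upair p p)"
proof -
  have "continuous_map Y (prod_topology Y Y) (\<lambda>p. (p, p))" by (intro continuous_map_pairedI) auto
  from continuous_map_compose[OF this quotient_imp_continuous_map[OF quotient_map_SP2]]
  show ?thesis by (simp add: o_def)
qed

section \<open>Motion planners with values in resolvable paths\<close>

lemma continuous_map_path_eval:
  "continuous_map (prod_topology (top_of_set {0..1}) (path_topology Z)) Z (\<lambda>(t, g). g t)"
  unfolding continuous_map_def
proof (intro conjI allI impI)
  let ?I = "top_of_set {0..1::real}"
  let ?P = "prod_topology ?I (path_topology Z)"
  have g_in: "g t \<in> topspace Z" if "g \<in> paths Z" "t \<in> {0..1}" for g t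
    using that by (auto simp: paths_def pathin_def continuous_map_def)
  then show "(\<lambda>(t, g). g t) \<in> topspace ?P \<rightarrow> topspace Z" by auto
  fix V assume V: "openin Z V"
  show "openin ?P {p \<in> topspace ?P. (case p of (t, g) \<Rightarrow> g t) \<in> V}" (is "openin _ ?S")
  proof (subst openin_subopen, intro ballI)
    fix p assume "p \<in> ?S"
    then obtain t g where p: "p = (t, g)" "t \<in> {0..1}" "g \<in> paths Z" "g t \<in> V" by auto
    have "openin ?I {s \<in> topspace ?I. g s \<in> V}"
      using p(3) V by (intro openin_continuous_map_preimage) (auto simp: paths_def pathin_def)
    then obtain T where T: "open T" "{s \<in> topspace ?I. g s \<in> V} = {0..1} \<inter> T"
      by (auto simp: openin_open)
    then have "t \<in> T" using p by auto
    then obtain e where e: "e > 0" "cball t e \<subseteq> T" using T(1) open_contains_cball by blast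
    \<comment> \<open>A compact neighbourhood \<open>K\<close> of \<open>t\<close> with \<open>g ` K \<subseteq> V\<close> turns the condition at time \<open>t\<close> into an open
      condition on paths.\<close>
    let ?K = "{0..1} \<inter> cball t e"
    let ?G = "{g \<in> paths Z. g ` ?K \<subseteq> V}"
    have "compact ?K" by (intro compact_Int compact_cball compact_Icc)
    then have "openin (path_topology Z) ?G"
      unfolding path_topology_def using V
      by (intro topology_generated_by_Basis) (auto intro!: exI[of _ ?K] exI[of _ V])
    moreover have "openin ?I ({0..1} \<inter> ball t e)" by (auto simp: openin_open)
    ultimately have "openin ?P (({0..1} \<inter> ball t e) \<times> ?G)" by (simp add: openin_prod_Times_iff)
    moreover have "g ` ?K \<subseteq> V" using e(2) T(2) by auto
    then have "p \<in> ({0..1} \<inter> ball t e) \<times> ?G" using p e(1) by simp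
    moreover have "({0..1} \<inter> ball t e) \<times> ?G \<subseteq> ?S" by auto
    ultimately show "\<exists>T. openin ?P T \<and> p \<in> T \<and> T \<subseteq> ?S" by blast
  qed
qed

text \<open>
  If the path splits at time \<open>t1\<close>, the two paths that resolve it are distinguished by their position at
  time \<open>t1\<close>, so their weights are the weights of the atoms at time \<open>t1\<close>. At any other time an atom carries
  the weight of one of them, or of both.
\<close>

lemma resolvable_path_atoms:
  assumes f: "f \<in> resolvable_paths n m" and n: "n \<le> 2"
    and t1: "t1 \<in> {0..1}" "x \<in> set_pmf (f t1)" "y \<in> set_pmf (f t1)" "x \<noteq> y"
    and t: "t \<in> {0..1}" and a: "a \<in> set_pmf (f t)"
  obtains b where "b \<in> set_pmf (f t1)" "pmf (f t1) b \<le> pmf (f t) a"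
proof -
  obtain \<mu> where \<mu>: "\<mu> \<in> fin_measures n (paths (mtopology_of m))" "f = measure_path \<mu>"
    using f by (auto simp: resolvable_paths_def)
  have f_eq: "f s = map_pmf (\<lambda>\<alpha>. \<alpha> s) \<mu>" if "s \<in> {0..1}" for s
    using that by (simp add: \<mu>(2) measure_path_def)
  obtain \<alpha> \<beta> where \<alpha>\<beta>: "set_pmf \<mu> = {\<alpha>, \<beta>}" by (rule fin_measures_2_support[OF \<mu>(1) n])
  have inj: "inj_on (\<lambda>\<alpha>. \<alpha> t1) (set_pmf \<mu>)"
    using t1 \<alpha>\<beta> by (auto simp: f_eq inj_on_def)
  obtain \<gamma> where \<gamma>: "\<gamma> \<in> set_pmf \<mu>" "a = \<gamma> t" using a t by (auto simp: f_eq)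
  have "pmf (f t1) (\<gamma> t1) = measure_pmf.prob \<mu> ((\<lambda>\<alpha>. \<alpha> t1) -` {\<gamma> t1} \<inter> set_pmf \<mu>)"
    using t1 by (simp add: f_eq pmf_map measure_Int_set_pmf)
  also have "(\<lambda>\<alpha>. \<alpha> t1) -` {\<gamma> t1} \<inter> set_pmf \<mu> = {\<gamma>}" using inj \<gamma>(1) by (auto simp: inj_on_def)
  also have "measure_pmf.prob \<mu> {\<gamma>} \<le> measure_pmf.prob \<mu> ((\<lambda>\<alpha>. \<alpha> t) -` {a})"
    by (rule measure_pmf.finite_measure_mono) (auto simp: \<gamma>(2))
  also have "\<dots> = pmf (f t) a" using t by (simp add: f_eq pmf_map)
  finally have "pmf (f t1) (\<gamma> t1) \<le> pmf (f t) a" .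
  moreover have "\<gamma> t1 \<in> set_pmf (f t1)" using \<gamma>(1) t1 by (simp add: f_eq)
  ultimately show thesis using that by blast
qed

lemma planner_eval:
  assumes "continuous_map P (RP n m) s"
  shows "continuous_map (prod_topology (top_of_set {0..1}) P) (mtopology_of (fin_measures_metric n m))
    (\<lambda>(t, p). s p t)"
proof -
  let ?I = "top_of_set {0..1::real}"
  have "continuous_map P (path_topology (mtopology_of (fin_measures_metric n m))) s"
    using assms by (simp add: RP_def continuous_map_in_subtopology)
  then have "continuous_map (prod_topology ?I P)
      (prod_topology ?I (path_topology (mtopology_of (fin_measures_metric n m)))) (\<lambda>(t, p). (t, s p))"
    by (auto simp: case_prod_unfold intro!: continuous_map_pairedI continuous_map_fst
        continuous_map_compose[OF continuous_map_snd, unfolded o_def])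
  from continuous_map_compose[OF this continuous_map_path_eval] show ?thesis
    by (simp add: o_def case_prod_unfold)
qed

text \<open>
  An instance of the tube lemma: \<open>[0, 1]\<close> is compact.
\<close>

lemma openin_all_times:
  assumes "continuous_map (prod_topology (top_of_set {0..1}) P) B (\<lambda>(t, p). s p t)" "openin B W"
  shows "openin P {p \<in> topspace P. \<forall>t\<in>{0..1::real}. s p t \<in> W}" (is "openin P ?U")
proof (subst openin_subopen, intro ballI)
  let ?I = "top_of_set {0..1::real}"
  fix p assume p: "p \<in> ?U"
  define G where "G = {q \<in> topspace (prod_topology ?I P). (case q of (t, p) \<Rightarrow> s p t) \<in> W}"
  have "openin (prod_topology ?I P) G"
    unfolding G_def by (rule openin_continuous_map_preimage[OF assms])
  moreover have "compactin ?I {0..1}" by (simp add: compactin_subtopology)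
  moreover have "p \<in> topspace P" "{0..1} \<times> {p} \<subseteq> G" using p by (auto simp: G_def)
  ultimately have "\<exists>A C. openin ?I A \<and> openin P C \<and> {0..1} \<subseteq> A \<and> p \<in> C \<and> A \<times> C \<subseteq> G"
    by (rule tube_lemma_left)
  then obtain A C where AC: "openin P C" "{0..1} \<subseteq> A" "p \<in> C" "A \<times> C \<subseteq> G" by blast
  have "c \<in> ?U" if "c \<in> C" for c
  proof -
    have "(t, c) \<in> G" if "t \<in> {0..1}" for t using AC(2,4) that \<open>c \<in> C\<close> by blast
    then show ?thesis using openin_subset[OF AC(1)] \<open>c \<in> C\<close> by (auto simp: G_def)
  qed
  with AC(1,3) show "\<exists>T. openin P T \<and> p \<in> T \<and> T \<subseteq> ?U" by blast
qed

lemma openin_some_time: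
  assumes "continuous_map (prod_topology (top_of_set {0..1}) P) B (\<lambda>(t, p). s p t)" "openin B W"
  shows "openin P {p \<in> topspace P. \<exists>t\<in>{0..1::real}. s p t \<in> W}"
proof -
  let ?I = "top_of_set {0..1::real}"
  have "continuous_map P B (\<lambda>p. s p t)" if "t \<in> {0..1}" for t
  proof -
    have "continuous_map P (prod_topology ?I P) (\<lambda>p. (t, p))"
      using that by (intro continuous_map_pairedI) auto
    from continuous_map_compose[OF this assms(1)] show ?thesis by (simp add: o_def)
  qed
  then have "openin P {p \<in> topspace P. s p t \<in> W}" if "t \<in> {0..1}" for t
    using that assms(2) by (intro openin_continuous_map_preimage)
  then have "openin P (\<Union>t\<in>{0..1}. {p \<in> topspace P. s p t \<in> W})"
    by (intro openin_Union) auto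
  also have "(\<Union>t\<in>{0..1}. {p \<in> topspace P. s p t \<in> W}) = {p \<in> topspace P. \<exists>t\<in>{0..1}. s p t \<in> W}"
    by auto
  finally show ?thesis .
qed

text \<open>
  Near \<open>(t0, p0)\<close> three conditions are imposed: the point \<open>x\<close> and the measure at time \<open>t\<close> stay close, and
  the measure at a time \<open>t1\<close> at which the path of \<open>p0\<close> splits stays close. The last one bounds the weights
  at time \<open>t1\<close>, hence by resolvability the weights at time \<open>t\<close>, even if \<open>s p0 t0\<close> is a Dirac measure.
\<close>

lemma planner_pairs_continuous:
  fixes m :: "'a metric" and P :: "('a \<times> 'a) topology"
  defines "X \<equiv> mtopology_of m"
  assumes s: "continuous_map P (RP n m) s" and n: "n \<le> 2"
    and x: "continuous_map P X fst"
    and split: "\<And>p. p \<in> topspace P \<Longrightarrow> \<exists>t\<in>{0..1}. s p t \<notin> Diracs m"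
  shows "continuous_map (prod_topology (top_of_set {0..1}) P) (SP2 (prod_topology X X))
    (\<lambda>(t, p). supp_pair (fst p) (s p t))"
  unfolding continuous_map_def
proof (intro conjI allI impI)
  let ?I = "top_of_set {0..1::real}"
  let ?Q = "prod_topology ?I P" and ?B = "fin_measures n (mspace m)"
  interpret B: Metric_space ?B "LP_dist m" by (rule Metric_space_fin_measures)
  interpret M: Metric_space "mspace m" "mdist m" by simp
  have F: "continuous_map ?Q B.mtopology (\<lambda>(t, p). s p t)"
    using planner_eval[OF s] by (simp add: mtopology_fin_measures)
  have X: "X = M.mtopology" by (simp add: X_def mtopology_of_def)
  have sB: "s p t \<in> ?B" if "p \<in> topspace P" "t \<in> {0..1}" for p t
    using funcset_mem[OF continuous_map_funspace[OF F], of "(t, p)"] that by simp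
  have res: "s p \<in> resolvable_paths n m" if "p \<in> topspace P" for p
    using s that by (auto simp: RP_def continuous_map_def)
  have xm: "fst p \<in> mspace m" if "p \<in> topspace P" for p
    using x that by (auto simp: X continuous_map_def)
  show "(\<lambda>(t, p). supp_pair (fst p) (s p t)) \<in> topspace ?Q \<rightarrow> topspace (SP2 (prod_topology X X))"
  proof (rule funcsetI)
    fix q assume "q \<in> topspace ?Q"
    then obtain t p where q: "q = (t, p)" "t \<in> {0..1}" "p \<in> topspace P" by auto
    obtain u v where uv: "set_pmf (s p t) = {u, v}" "u \<in> mspace m" "v \<in> mspace m"
      by (rule fin_measures_2_support[OF sB[OF q(3,2)] n])
    then show "(case q of (t, p) \<Rightarrow> supp_pair (fst p) (s p t)) \<in> topspace (SP2 (prod_topology X X))"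
      using xm[OF q(3)] q(1) by (auto simp: supp_pair_eq topspace_SP2 X image_iff)
  qed
  fix G assume G: "openin (SP2 (prod_topology X X)) G"
  show "openin ?Q {q \<in> topspace ?Q. (case q of (t, p) \<Rightarrow> supp_pair (fst p) (s p t)) \<in> G}" (is "openin _ ?S")
  proof (subst openin_subopen, intro ballI)
    fix q assume "q \<in> ?S"
    then obtain t0 p0 where q: "q = (t0, p0)" "t0 \<in> {0..1}" "p0 \<in> topspace P"
      "supp_pair (fst p0) (s p0 t0) \<in> G" by auto
    obtain t1 where t1: "t1 \<in> {0..1}" "s p0 t1 \<notin> Diracs m" using split[OF q(3)] by blast
    obtain e1 c where e1: "e1 > 0" "c > 0"
      "\<And>\<nu>. \<lbrakk>\<nu> \<in> ?B; LP_dist m (s p0 t1) \<nu> < e1\<rbrakk> \<Longrightarrow>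
         \<nu> \<notin> Diracs m \<and> (\<forall>a\<in>set_pmf \<nu>. c \<le> pmf \<nu> a)"
      using not_Dirac_near[OF sB[OF q(3) t1(1)] t1(2) n] by blast
    obtain e where e: "e > 0" "\<And>x \<nu>. \<lbrakk>x \<in> mspace m; \<nu> \<in> ?B; mdist m (fst p0) x < e;
      LP_dist m (s p0 t0) \<nu> < e; \<And>a. a \<in> set_pmf \<nu> \<Longrightarrow> c \<le> pmf \<nu> a\<rbrakk> \<Longrightarrow> supp_pair x \<nu> \<in> G"
      using supp_pair_near[OF sB[OF q(3,2)] n xm[OF q(3)] e1(2) G[unfolded X_def] q(4)] by blast
    let ?N1 = "{q \<in> topspace ?Q. (\<lambda>(t, p). s p t) q \<in> B.mball (s p0 t0) e}"
    let ?N2 = "{q \<in> topspace ?Q. (fst \<circ> snd) q \<in> M.mball (fst p0) e}"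
    let ?N3 = "{q \<in> topspace ?Q. ((\<lambda>(t, p). s p t) \<circ> (\<lambda>q. (t1, snd q))) q \<in> B.mball (s p0 t1) e1}"
    have c2: "continuous_map ?Q M.mtopology (fst \<circ> snd)"
      using continuous_map_compose[OF continuous_map_snd x] by (simp add: X)
    have "continuous_map ?Q ?Q (\<lambda>q. (t1, snd q))"
      using t1(1) by (intro continuous_map_pairedI continuous_map_snd) auto
    then have c3: "continuous_map ?Q B.mtopology ((\<lambda>(t, p). s p t) \<circ> (\<lambda>q. (t1, snd q)))"
      using F by (rule continuous_map_compose)
    have "openin ?Q ?N1" by (rule openin_continuous_map_preimage[OF F B.openin_mball])
    moreover have "openin ?Q ?N2" by (rule openin_continuous_map_preimage[OF c2 M.openin_mball])
    moreover have "openin ?Q ?N3" by (rule openin_continuous_map_preimage[OF c3 B.openin_mball])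
    ultimately have "openin ?Q (?N1 \<inter> ?N2 \<inter> ?N3)" by blast
    moreover have "q \<in> ?N1 \<inter> ?N2 \<inter> ?N3"
      using q e(1) e1(1) t1 sB[OF q(3,2)] sB[OF q(3) t1(1)] xm[OF q(3)] by simp
    moreover have "?N1 \<inter> ?N2 \<inter> ?N3 \<subseteq> ?S"
    proof
      fix r assume "r \<in> ?N1 \<inter> ?N2 \<inter> ?N3"
      then obtain t p where r: "r = (t, p)" "t \<in> {0..1}" "p \<in> topspace P"
        "LP_dist m (s p0 t0) (s p t) < e" "mdist m (fst p0) (fst p) < e"
        "LP_dist m (s p0 t1) (s p t1) < e1" by auto
      have near: "s p t1 \<notin> Diracs m" "\<And>a. a \<in> set_pmf (s p t1) \<Longrightarrow> c \<le> pmf (s p t1) a"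
        using e1(3)[OF sB[OF r(3) t1(1)] r(6)] by blast+
      obtain u v where uv: "u \<in> set_pmf (s p t1)" "v \<in> set_pmf (s p t1)" "u \<noteq> v"
        by (rule not_Dirac_atoms[OF sB[OF r(3) t1(1)] near(1)])
      have "c \<le> pmf (s p t) a" if a: "a \<in> set_pmf (s p t)" for a
      proof -
        obtain b where "b \<in> set_pmf (s p t1)" "pmf (s p t1) b \<le> pmf (s p t) a"
          by (rule resolvable_path_atoms[OF res[OF r(3)] n t1(1) uv r(2) a])
        then show ?thesis using near(2) by fastforce
      qed
      then have "supp_pair (fst p) (s p t) \<in> G"
        using r xm sB by (intro e(2)) auto
      then show "r \<in> ?S" using r by simp
    qed
    ultimately show "\<exists>T. openin ?Q T \<and> q \<in> T \<and> T \<subseteq> ?S" by blast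
  qed
qed

text \<open>
  \<open>U\<close> is the set where the planner stays in a neighbourhood of the Dirac measures that retracts to \<open>X\<close>, and
  \<open>V\<close> the set where it leaves the Dirac measures at some time.
\<close>

lemma planner_cover:
  fixes m :: "'a metric"
  defines "X \<equiv> mtopology_of m"
  defines "XX \<equiv> prod_topology X X"
  assumes X: "ANR_space X" and n: "1 \<le> n" "n \<le> 2" and s: "continuous_map XX (RP n m) s"
    and ends: "\<And>x y. \<lbrakk>x \<in> mspace m; y \<in> mspace m\<rbrakk> \<Longrightarrow>
      s (x, y) 0 = return_pmf x \<and> s (x, y) 1 = return_pmf y"
  obtains U V where "openin XX U" "openin XX V" "topspace XX \<subseteq> U \<union> V"
    "homotopic_with (\<lambda>_. True) (subtopology XX U) XX (\<lambda>p. (fst p, fst p)) id"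
    "homotopic_with (\<lambda>_. True) (subtopology XX V) (SP2 XX)
       (\<lambda>p. Upair (fst p, fst p) (fst p, fst p)) (\<lambda>p. Upair p p)"
proof -
  let ?I = "top_of_set {0..1::real}"
  let ?B = "mtopology_of (fin_measures_metric n m)"
  have F: "continuous_map (prod_topology ?I XX) ?B (\<lambda>(t, p). s p t)"
    by (rule planner_eval[OF s])
  have top_XX: "topspace XX = mspace m \<times> mspace m" by (simp add: XX_def X_def)
  have mB: "metrizable_space ?B"
    by (simp add: mtopology_fin_measures Metric_space.metrizable_space_mtopology
        Metric_space_fin_measures)
  have inj: "inj_on pmf (topspace ?B)" by (auto simp: inj_on_def pmf_eq_iff)
  obtain W r where W: "openin ?B W" "Diracs m \<subseteq> W"
    "continuous_map (subtopology ?B W) X r" "\<And>x. x \<in> topspace X \<Longrightarrow> r (return_pmf x) = x"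
    using ANR_space_neighbourhood_retraction[OF X mB inj closedin_Diracs[OF n(1)]
        homeomorphic_maps_return_pmf[OF n(1), of m, folded X_def]] by metis
  define U where "U = {p \<in> topspace XX. \<forall>t\<in>{0..1}. s p t \<in> W}"
  define V where "V = {p \<in> topspace XX. \<exists>t\<in>{0..1}. s p t \<in> topspace ?B - Diracs m}"
  have U: "openin XX U" unfolding U_def by (rule openin_all_times[OF F W(1)])
  have V: "openin XX V" unfolding V_def
    using closedin_Diracs[OF n(1), of m] by (intro openin_some_time[OF F]) (simp add: closedin_def)
  have sB: "s p t \<in> topspace ?B" if "p \<in> topspace XX" "t \<in> {0..1}" for p t
    using funcset_mem[OF continuous_map_funspace[OF F], of "(t, p)"] that by simp
  have cover: "topspace XX \<subseteq> U \<union> V"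
    using sB W(2) by (auto simp: U_def V_def)
  have fstX: "continuous_map (subtopology XX A) X fst" for A
    unfolding XX_def by (intro continuous_map_from_subtopology continuous_map_fst)
  have incl: "continuous_map (prod_topology ?I (subtopology XX A)) (prod_topology ?I XX) id" for A
    using continuous_map_pairedI[OF continuous_map_fst
        continuous_map_into_fulltopology[OF continuous_map_snd], of ?I XX A]
    by (simp add: id_def)
  have hU: "homotopic_with (\<lambda>_. True) (subtopology XX U) XX (\<lambda>p. (fst p, fst p)) id"
    unfolding homotopic_with[where P = "\<lambda>_. True", simplified]
  proof (intro exI conjI ballI)
    let ?Q = "prod_topology ?I (subtopology XX U)"
    have "continuous_map ?Q ?B (\<lambda>(t, p). s p t)"
      using continuous_map_compose[OF incl F] by simp
    then have "continuous_map ?Q (subtopology ?B W) (\<lambda>(t, p). s p t)"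
      by (auto simp: continuous_map_in_subtopology U_def)
    from continuous_map_compose[OF this W(3)]
    have "continuous_map ?Q X (\<lambda>q. r (s (snd q) (fst q)))" by (simp add: o_def case_prod_unfold)
    moreover have "continuous_map ?Q X (\<lambda>q. fst (snd q))"
      using continuous_map_compose[OF continuous_map_snd fstX] by (simp add: o_def)
    ultimately show "continuous_map ?Q XX (\<lambda>q. (fst (snd q), r (s (snd q) (fst q))))"
      unfolding XX_def by (intro continuous_map_pairedI)
    fix p assume "p \<in> topspace (subtopology XX U)"
    then have p: "fst p \<in> mspace m" "snd p \<in> mspace m" by (auto simp: top_XX)
    show "(fst (snd (0, p)), r (s (snd (0, p)) (fst (0::real, p)))) = (fst p, fst p)"
      "(fst (snd (1, p)), r (s (snd (1, p)) (fst (1::real, p)))) = id p"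
      using ends[OF p] W(4) p by (auto simp: X_def)
  qed
  have hV: "homotopic_with (\<lambda>_. True) (subtopology XX V) (SP2 XX)
       (\<lambda>p. Upair (fst p, fst p) (fst p, fst p)) (\<lambda>p. Upair p p)"
    unfolding homotopic_with[where P = "\<lambda>_. True", simplified]
  proof (intro exI conjI ballI)
    show "continuous_map (prod_topology ?I (subtopology XX V)) (SP2 XX)
        (\<lambda>(t, p). supp_pair (fst p) (s p t))"
      unfolding XX_def X_def
    proof (rule planner_pairs_continuous[OF _ n(2)], fold X_def, fold XX_def)
      show "continuous_map (subtopology XX V) (RP n m) s"
        by (rule continuous_map_from_subtopology[OF s])
    qed (auto simp: V_def fstX)
    fix p assume "p \<in> topspace (subtopology XX V)"
    then have p: "fst p \<in> mspace m" "snd p \<in> mspace m" by (auto simp: top_XX)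
    show "(\<lambda>(t, p). supp_pair (fst p) (s p t)) (0::real, p) = Upair (fst p, fst p) (fst p, fst p)"
      "(\<lambda>(t, p). supp_pair (fst p) (s p t)) (1::real, p) = Upair p p"
      using ends[OF p] supp_pair_eq[of "return_pmf (fst p)" "fst p" "fst p" "fst p"]
        supp_pair_eq[of "return_pmf (snd p)" "snd p" "snd p" "fst p"] by simp_all
  qed
  show thesis by (rule that[OF U V cover hU hV])
qed

section \<open>Zero-divisors and intertwining topological complexity\<close>

theorem theorem7p12:
  fixes m :: "'a metric" and X :: "'a topology" and k1 k2 :: nat
    and \<beta>1s \<beta>2s :: "(('a \<times> 'a) uprod list \<Rightarrow> 'r::ring_1) set"
    and \<beta>1 \<beta>2 :: "(('a \<times> 'a) list \<Rightarrow> 'r) set"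
  assumes "X = mtopology_of m"
    and "path_connected_space X"
    and "ANR_space X"
    and "k1 \<ge> 1" and "k2 \<ge> 1"
    and "\<beta>1s \<in> carrier (AS_cohomology k1 (SP2 (prod_topology X X)))"
    and "\<beta>2s \<in> carrier (AS_cohomology k2 (SP2 (prod_topology X X)))"
    and "\<beta>1 = AS_induced k1 (prod_topology X X) (\<lambda>p. Upair p p) \<beta>1s"
    and "\<beta>2 = AS_induced k2 (prod_topology X X) (\<lambda>p. Upair p p) \<beta>2s"
    and "AS_zero_divisor k1 X \<beta>1"
    and "AS_zero_divisor k2 X \<beta>2"
    and "AS_cup k1 k2 (prod_topology X X) \<beta>1 \<beta>2
           \<noteq> \<one>\<^bsub>AS_cohomology (k1 + k2) (prod_topology X X)\<^esub>"
  shows "iTC m \<ge> 2"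
proof -
  let ?XX = "prod_topology X X"
  let ?diag = "\<lambda>p. Upair p p"
  let ?\<Delta> = "\<lambda>x. (x, x)"
  obtain q1 q2 where k: "k1 = Suc q1" "k2 = Suc q2"
    using assms(4,5) by (metis One_nat_def Suc_le_D)
  have XX: "metrizable_space ?XX"
    using assms(3) by (simp add: ANR_space_def metrizable_space_prod_topology)
  have \<Delta>: "continuous_map X ?XX ?\<Delta>" by (intro continuous_map_pairedI) auto
  have diag: "continuous_map ?XX (SP2 ?XX) ?diag" by (rule continuous_map_diagonal_SP2)
  \<comment> \<open>Passage to cochains: \<open>\<beta>\<close> is represented by the pullback of a cocycle \<open>\<phi>s\<close> of the symmetric
    square, and being a zero-divisor says that its pullback along \<open>\<Delta>\<close> is a coboundary.\<close>
  have represent: "\<exists>\<phi>s \<in> AS_cocycles k (SP2 ?XX). \<beta> = AS_class k ?XX (AS_pullback k ?XX ?diag \<phi>s) \<and>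
      AS_pullback k X ?\<Delta> (AS_pullback k ?XX ?diag \<phi>s) \<in> AS_coboundaries k X"
    if \<beta>s: "\<beta>s \<in> carrier (AS_cohomology k (SP2 ?XX))" and \<beta>: "\<beta> = AS_induced k ?XX ?diag \<beta>s"
      and zd: "AS_zero_divisor k X \<beta>" for k \<beta> and \<beta>s :: "(('a \<times> 'a) uprod list \<Rightarrow> 'r) set"
  proof -
    obtain \<phi>s where \<phi>s: "\<phi>s \<in> AS_cocycles k (SP2 ?XX)" "\<beta>s = AS_class k (SP2 ?XX) \<phi>s"
      using \<beta>s unfolding carrier_AS_cohomology by blast
    have eq: "\<beta> = AS_class k ?XX (AS_pullback k ?XX ?diag \<phi>s)"
      unfolding \<beta> \<phi>s(2) by (rule AS_induced_class[OF diag])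
    have "AS_class k X (AS_pullback k X ?\<Delta> (AS_pullback k ?XX ?diag \<phi>s)) = AS_class k X (\<lambda>_. 0)"
      using zd unfolding AS_zero_divisor_def eq AS_induced_class[OF \<Delta>] one_AS_cohomology by blast
    then have "AS_pullback k X ?\<Delta> (AS_pullback k ?XX ?diag \<phi>s) \<in> AS_class k X (\<lambda>_. 0)"
      using AS_class_self by blast
    then show ?thesis using \<phi>s(1) eq by (auto simp: mem_AS_class)
  qed
  obtain \<phi>s where \<phi>s: "\<phi>s \<in> AS_cocycles k1 (SP2 ?XX)"
    "\<beta>1 = AS_class k1 ?XX (AS_pullback k1 ?XX ?diag \<phi>s)"
    "AS_pullback k1 X ?\<Delta> (AS_pullback k1 ?XX ?diag \<phi>s) \<in> AS_coboundaries k1 X"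
    using represent[OF assms(6,8,10)] by blast
  obtain \<psi>s where \<psi>s: "\<psi>s \<in> AS_cocycles k2 (SP2 ?XX)"
    "\<beta>2 = AS_class k2 ?XX (AS_pullback k2 ?XX ?diag \<psi>s)"
    "AS_pullback k2 X ?\<Delta> (AS_pullback k2 ?XX ?diag \<psi>s) \<in> AS_coboundaries k2 X"
    using represent[OF assms(7,9,11)] by blast
  define \<phi> where "\<phi> = AS_pullback k1 ?XX ?diag \<phi>s"
  define \<psi> where "\<psi> = AS_pullback k2 ?XX ?diag \<psi>s"
  have \<phi>: "\<phi> \<in> AS_cocycles k1 ?XX" and \<psi>: "\<psi> \<in> AS_cocycles k2 ?XX"
    unfolding \<phi>_def \<psi>_def by (intro AS_pullback_cocycle[OF diag] \<phi>s(1) \<psi>s(1))+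
  have no_planner: False if n: "n \<le> 1" and s: "continuous_map ?XX (RP (Suc n) m) s"
    "\<forall>x\<in>mspace m. \<forall>y\<in>mspace m. s (x, y) 0 = return_pmf x \<and> s (x, y) 1 = return_pmf y" for n s
  proof -
    have ends: "s (x, y) 0 = return_pmf x \<and> s (x, y) 1 = return_pmf y"
      if "x \<in> mspace m" "y \<in> mspace m" for x y using s(2) that by blast
    have "1 \<le> Suc n" "Suc n \<le> 2" using n by auto
    from planner_cover[of m, folded assms(1), OF assms(3) this s(1) ends]
    obtain U V where UV: "openin ?XX U" "openin ?XX V" "topspace ?XX \<subseteq> U \<union> V"
      "homotopic_with (\<lambda>_. True) (subtopology ?XX U) ?XX (\<lambda>p. (fst p, fst p)) id"
      "homotopic_with (\<lambda>_. True) (subtopology ?XX V) (SP2 ?XX)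
         (\<lambda>p. Upair (fst p, fst p) (fst p, fst p)) ?diag"
      by blast
    have sub: "metrizable_space (subtopology ?XX A)" for A by (rule metrizable_space_subtopology[OF XX])
    have fstX: "continuous_map (subtopology ?XX A) X fst" for A
      by (intro continuous_map_from_subtopology continuous_map_fst)
    have incl: "continuous_map (subtopology ?XX A) ?XX id" for A
      by (rule continuous_map_from_subtopology) simp
    have "AS_pullback k1 (subtopology ?XX U) (\<lambda>p. (fst p, fst p)) \<phi> =
        AS_pullback k1 (subtopology ?XX U) fst (AS_pullback k1 X ?\<Delta> \<phi>)"
      by (simp add: AS_pullback_compose[OF fstX] o_def)
    also have "\<dots> \<in> AS_coboundaries k1 (subtopology ?XX U)"
      unfolding \<phi>_def by (rule AS_pullback_coboundary[OF fstX \<phi>s(3)])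
    finally have 1: "AS_pullback k1 (subtopology ?XX U) id \<phi> \<in> AS_coboundaries k1 (subtopology ?XX U)"
      using AS_pullback_coboundary_homotopic[OF sub UV(4)] \<phi> unfolding k by blast
    have "AS_pullback k2 (subtopology ?XX V) (\<lambda>p. Upair (fst p, fst p) (fst p, fst p)) \<psi>s =
        AS_pullback k2 (subtopology ?XX V) fst (AS_pullback k2 X ?\<Delta> \<psi>)"
      by (simp add: AS_pullback_compose[OF fstX] AS_pullback_compose[OF \<Delta>] o_def \<psi>_def)
    also have "\<dots> \<in> AS_coboundaries k2 (subtopology ?XX V)"
      unfolding \<psi>_def by (rule AS_pullback_coboundary[OF fstX \<psi>s(3)])
    finally have "AS_pullback k2 (subtopology ?XX V) ?diag \<psi>s \<in> AS_coboundaries k2 (subtopology ?XX V)"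
      using AS_pullback_coboundary_homotopic[OF sub UV(5)] \<psi>s(1) unfolding k by blast
    then have 2: "AS_pullback k2 (subtopology ?XX V) id \<psi> \<in> AS_coboundaries k2 (subtopology ?XX V)"
      by (simp add: \<psi>_def AS_pullback_compose[OF incl] o_def)
    show False
      using AS_cup_open_cover[OF \<phi> \<psi> UV(1-3) 1 2] assms(12) \<phi>s(2) \<psi>s(2) by (simp add: \<phi>_def \<psi>_def)
  qed
  have "2 \<le> n" if "\<exists>s. continuous_map ?XX (RP (Suc n) m) s \<and>
      (\<forall>x\<in>mspace m. \<forall>y\<in>mspace m. s (x, y) 0 = return_pmf x \<and> s (x, y) 1 = return_pmf y)" for n
    using that no_planner[of n] by (cases "n \<le> 1") auto
  then show ?thesis
    unfolding iTC_def assms(1)[symmetric]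
    by (intro Inf_greatest) (elim CollectE exE conjE, simp only: numeral_eq_enat enat_ord_simps, blast)
qed

end
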